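(* There are absolute constants $\lambda_1,\lambda_2>0$ such that for all $n\ge2$ and all $k=1,\dots,n$, $$\lambda_1\sqrt{\frac{n}{k\log n}}\le\mathrm{mmc}(\Phi_{(k)})\le\lambda_2\sqrt{\frac{n}{k}}\qquad\text{and}\qquad \lambda_1\sqrt{\frac{k}{\log(k)+1}}\le\mathrm{mmc}(\Phi'_{(k)})\le\lambda_2\sqrt{k}.$$
   Context: $\Phi_{(k)}$ is the top-$k$ norm on $\mathbb{R}^n$: $\Phi_{(k)}(x)=\sum_{i=1}^k|x|_{[i]}$, where $|x|_{[1]}\ge\dots\ge|x|_{[n]}$ are the absolute values of the coordinates of $x$ in non-increasing order. $\Phi'_{(k)}$ is its dual norm on $\mathbb{R}^n$, which is $\Phi'_{(k)}(x)=\max\{l_\infty(x),\,l_1(x)/k\}$, where $l_p$ denotes the usual $\ell_p$ norm. Both are symmetric norms (invariant under coordinate permutations and sign flips). For a symmetric norm $l$ on $\mathbb{R}^n$ and $j\le n$, $l^{(j)}$ is the norm on $\mathbb{R}^j$ given by $l^{(j)}(x_1,\dots,x_j)=l(x_1,\dots,x_j,0,\dots,0)$. For a norm $l$ on $\mathbb{R}^j$, $\mathfrak{b}_l=\max\{l(x):x\in S^{j-1}\}$, where $S^{j-1}$ is the $\ell_2$ unit sphere, and $\mathrm{M}_l$ is the (unique) median of $l(X)$ for $X$ uniform on $S^{j-1}$. $\mathrm{mc}(l)=\mathfrak{b}_l/\mathrm{M}_l$ and $\mathrm{mmc}(l)=\max_{1\le j\le n}\mathrm{mc}(l^{(j)})$.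 *)

theory Defs
  imports "HOL-Probability.Probability"
begin

text \<open>
  The dimension has to range over the natural numbers, so \<open>\<real>\<^sup>n\<close> is modelled as the space
  \<open>{..<n} \<rightarrow>\<^sub>E UNIV\<close> of the product measure \<open>\<Pi>\<^sub>M i\<in>{..<n}. lborel\<close>; the coordinates are
  indexed by \<open>0, \<dots>, n - 1\<close>.
\<close>

definition rn :: "nat \<Rightarrow> (nat \<Rightarrow> real) set" where
  "rn n = ({..<n} \<rightarrow>\<^sub>E UNIV)"

definition rn_lebesgue :: "nat \<Rightarrow> (nat \<Rightarrow> real) measure" where
  "rn_lebesgue n = (\<Pi>\<^sub>M i\<in>{..<n}. lborel)"

definition rn_sphere :: "nat \<Rightarrow> (nat \<Rightarrow> real) set" where
  "rn_sphere n = {x \<in> rn n. L2_set x {..<n} = 1}"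

definition rn_ball :: "nat \<Rightarrow> (nat \<Rightarrow> real) set" where
  "rn_ball n = {x \<in> rn n. L2_set x {..<n} \<le> 1}"

definition normalize_vec :: "nat \<Rightarrow> (nat \<Rightarrow> real) \<Rightarrow> nat \<Rightarrow> real" where
  "normalize_vec n x = (\<lambda>i\<in>{..<n}. x i / L2_set x {..<n})"

text \<open>
  The uniform distribution on the sphere as the normalized cone measure: a set \<open>A\<close> of unit
  vectors has mass \<open>vol {t x | x \<in> A, 0 < t \<le> 1} / vol (ball)\<close>, i.e. this is the law of
  \<open>Y / \<bar>Y\<bar>\<close> for \<open>Y\<close> uniform in the unit ball. It is a measure on the whole of \<open>\<real>\<^sup>n\<close>, concentrated
  on the sphere. The origin, where \<open>normalize_vec\<close> returns 0, is a null set for \<open>n \<ge> 1\<close>.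
\<close>

definition sphere_uniform :: "nat \<Rightarrow> (nat \<Rightarrow> real) measure" where
  "sphere_uniform n =
     distr (uniform_measure (rn_lebesgue n) (rn_ball n)) (rn_lebesgue n) (normalize_vec n)"

definition is_median :: "'a measure \<Rightarrow> ('a \<Rightarrow> real) \<Rightarrow> real \<Rightarrow> bool" where
  "is_median P f m \<longleftrightarrow>
     measure P {x \<in> space P. f x \<le> m} \<ge> 1 / 2 \<and> measure P {x \<in> space P. f x \<ge> m} \<ge> 1 / 2"

text \<open>
  In the functionals below, \<open>l\<close> is a norm on \<open>\<real>\<^sup>j\<close>. It is continuous, so the supremum over the
  compact sphere is attained.
\<close>

definition max_sphere :: "nat \<Rightarrow> ((nat \<Rightarrow> real) \<Rightarrow> real) \<Rightarrow> real" where
  "max_sphere j l = (SUP x\<in>rn_sphere j. l x)"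

definition median_sphere :: "nat \<Rightarrow> ((nat \<Rightarrow> real) \<Rightarrow> real) \<Rightarrow> real" where
  "median_sphere j l = (THE m. is_median (sphere_uniform j) l m)"

definition mc :: "nat \<Rightarrow> ((nat \<Rightarrow> real) \<Rightarrow> real) \<Rightarrow> real" where
  "mc j l = max_sphere j l / median_sphere j l"

definition pad_zeros :: "nat \<Rightarrow> nat \<Rightarrow> (nat \<Rightarrow> real) \<Rightarrow> nat \<Rightarrow> real" where
  "pad_zeros n j x = (\<lambda>i\<in>{..<n}. if i < j then x i else 0)"

definition restrict_norm :: "nat \<Rightarrow> ((nat \<Rightarrow> real) \<Rightarrow> real) \<Rightarrow> nat \<Rightarrow> (nat \<Rightarrow> real) \<Rightarrow> real" where
  "restrict_norm n l j x = l (pad_zeros n j x)"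

definition mmc :: "nat \<Rightarrow> ((nat \<Rightarrow> real) \<Rightarrow> real) \<Rightarrow> real" where
  "mmc n l = Max ((\<lambda>j. mc j (restrict_norm n l j)) ` {1..n})"

text \<open>\<open>abs_desc n x i\<close> is \<open>\<bar>x\<bar>\<^bsub>[i]\<^esub>\<close>, with \<open>i\<close> counted from 1.\<close>

definition abs_desc :: "nat \<Rightarrow> (nat \<Rightarrow> real) \<Rightarrow> nat \<Rightarrow> real" where
  "abs_desc n x i = rev (sort (map (\<lambda>i. \<bar>x i\<bar>) [0..<n])) ! (i - 1)"

definition topk_norm :: "nat \<Rightarrow> nat \<Rightarrow> (nat \<Rightarrow> real) \<Rightarrow> real" where
  "topk_norm n k x = (\<Sum>i = 1..k. abs_desc n x i)"

definition dual_norm :: "nat \<Rightarrow> ((nat \<Rightarrow> real) \<Rightarrow> real) \<Rightarrow> (nat \<Rightarrow> real) \<Rightarrow> real" where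
  "dual_norm n l y = (SUP x\<in>{x \<in> rn n. l x \<le> 1}. \<Sum>i<n. x i * y i)"

end

theory Submission
  imports Defs
begin

text \<open>
  Two volume estimates for the unit ball \<open>B\<close> of \<open>\<real>\<^sup>n\<close> control all medians. Chernoff's method gives
  \<open>vol {x. l\<^sub>1 x \<le> c \<surd>n} \<le> (e c)\<^sup>n vol B\<close>, so the median of \<open>l\<^sub>1\<close> on the sphere is of order \<open>\<surd>n\<close>.
  A cap \<open>{x \<in> B. s < x\<^sub>i}\<close> fits after translation into a ball of radius \<open>\<surd>(1 - s\<^sup>2)\<close>, so by a union
  bound the median of \<open>l\<^sub>\<infinity>\<close> is at most a multiple of \<open>\<surd>((1 + ln n) / n)\<close>. On \<open>\<real>\<^sup>j\<close> with \<open>k \<le> j\<close> one has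
  \<open>(k / j) l\<^sub>1 \<le> \<Phi>\<^bsub>(k)\<^esub> \<le> k l\<^sub>\<infinity>\<close>, and \<open>\<Phi>\<^bsub>(k)\<^esub>\<close> has maximum \<open>\<surd>k\<close> on the sphere. The dual norm \<open>max l\<^sub>\<infinity> (l\<^sub>1 / k)\<close>
  has maximum at most \<open>max 1 (\<surd>j / k)\<close>, and its median \<open>M\<close> is at least a multiple of \<open>\<surd>j / k\<close> and at least
  \<open>1 / \<surd>j\<close>, whence \<open>M\<^sup>2\<close> is at least a multiple of \<open>1 / k\<close>; its lower bound comes from \<open>j = k\<close>, where
  it equals \<open>l\<^sub>\<infinity>\<close>.
\<close>

section \<open>Lebesgue measure on \<open>\<real>\<^sup>n\<close>\<close>

lemma space_rn_lebesgue [simp]: "space (rn_lebesgue n) = rn n"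
  by (simp add: rn_lebesgue_def rn_def space_PiM)

lemma measurable_coordinate [measurable]:
  "i < n \<Longrightarrow> (\<lambda>x. x i) \<in> borel_measurable (rn_lebesgue n)"
  unfolding rn_lebesgue_def
  using measurable_component_singleton[of i "{..<n}" "\<lambda>_. lborel :: real measure"] by simp

lemma measurable_into_rn:
  assumes "\<And>i. i < n \<Longrightarrow> (\<lambda>x. f x i) \<in> borel_measurable M"
  shows "(\<lambda>x. \<lambda>i\<in>{..<n}. f x i) \<in> measurable M (rn_lebesgue n)"
  unfolding rn_lebesgue_def by (rule measurable_restrict) (use assms in simp)

lemma measurable_L2_set_rn [measurable]:
  "(\<lambda>x. L2_set x {..<n}) \<in> borel_measurable (rn_lebesgue n)"
  unfolding L2_set_def
  by (rule measurable_compose[OF _ borel_measurable_sqrt], intro borel_measurable_sum borel_measurable_power)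
     (auto intro: measurable_coordinate)

lemma measurable_l1_rn [measurable]:
  "S \<subseteq> {..<n} \<Longrightarrow> (\<lambda>x. \<Sum>i\<in>S. \<bar>x i\<bar>) \<in> borel_measurable (rn_lebesgue n)"
  by (intro borel_measurable_sum borel_measurable_abs measurable_coordinate) auto

lemma sets_linf_rn: "{x \<in> rn n. \<exists>i<n. t < \<bar>x i\<bar>} \<in> sets (rn_lebesgue n)"
proof -
  have "(\<Union>i\<in>{..<n}. {x \<in> space (rn_lebesgue n). t < \<bar>x i\<bar>}) \<in> sets (rn_lebesgue n)"
  proof (intro sets.finite_UN)
    fix i assume "i \<in> {..<n}"
    then have [measurable]: "(\<lambda>x. x i) \<in> borel_measurable (rn_lebesgue n)"
      by (intro measurable_coordinate) simp
    show "{x \<in> space (rn_lebesgue n). t < \<bar>x i\<bar>} \<in> sets (rn_lebesgue n)" by measurable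
  qed simp
  also have "(\<Union>i\<in>{..<n}. {x \<in> space (rn_lebesgue n). t < \<bar>x i\<bar>}) = {x \<in> rn n. \<exists>i<n. t < \<bar>x i\<bar>}"
    by auto
  finally show ?thesis .
qed

lemma measurable_normalize_vec [measurable]:
  "normalize_vec n \<in> measurable (rn_lebesgue n) (rn_lebesgue n)"
  unfolding normalize_vec_def
  by (intro measurable_into_rn borel_measurable_divide measurable_coordinate measurable_L2_set_rn)

lemma sets_rn_ball [measurable]: "rn_ball n \<in> sets (rn_lebesgue n)"
proof -
  have "{x \<in> space (rn_lebesgue n). L2_set x {..<n} \<le> 1} \<in> sets (rn_lebesgue n)"
    by measurable
  then show ?thesis by (simp add: rn_ball_def)
qed

lemma product_sigma_finite_lborel: "product_sigma_finite (\<lambda>_. lborel :: real measure)"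
  by unfold_locales

lemma emeasure_rn_box:
  assumes "\<And>i. i < n \<Longrightarrow> a i \<le> b i"
  shows "emeasure (rn_lebesgue n) (\<Pi>\<^sub>E i\<in>{..<n}. {a i..b i}) = ennreal (\<Prod>i<n. b i - a i)"
  unfolding rn_lebesgue_def using assms
  by (subst product_sigma_finite.emeasure_PiM[OF product_sigma_finite_lborel])
     (auto intro!: prod_ennreal)

lemma sets_rn_box: "(\<Pi>\<^sub>E i\<in>{..<n}. {a i..b i}) \<in> sets (rn_lebesgue n)"
  unfolding rn_lebesgue_def by (intro sets_PiM_I_finite) auto

text \<open>Lebesgue measure is characterized by its values on product sets, where the
  one-dimensional affine rule applies in each coordinate and contributes one factor
  \<open>c\<close>. It will compare a cap with a smaller ball.\<close>

lemma emeasure_rn_affine: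
  assumes c: "c > 0" and A: "A \<in> sets (rn_lebesgue n)"
  shows "ennreal (c ^ n) * emeasure (rn_lebesgue n) {x \<in> rn n. (\<lambda>i\<in>{..<n}. a i + c * x i) \<in> A}
           = emeasure (rn_lebesgue n) A"
proof -
  let ?L = "rn_lebesgue n" and ?T = "\<lambda>x. \<lambda>i\<in>{..<n}. a i + c * x i"
  interpret product_sigma_finite "\<lambda>_. lborel :: real measure"
    by (rule product_sigma_finite_lborel)
  have T: "?T \<in> measurable ?L ?L"
    by (intro measurable_into_rn borel_measurable_add borel_measurable_times measurable_coordinate) auto
  have "scale_measure (ennreal (c ^ n)) (distr ?L ?L ?T) = (\<Pi>\<^sub>M i\<in>{..<n}. lborel)"
  proof (rule PiM_eqI)
    fix X :: "nat \<Rightarrow> real set" assume X: "\<And>i. i \<in> {..<n} \<Longrightarrow> X i \<in> sets lborel"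
    have XL: "Pi\<^sub>E {..<n} X \<in> sets ?L"
      unfolding rn_lebesgue_def using X by (intro sets_PiM_I_finite) auto
    have eq: "?T -` Pi\<^sub>E {..<n} X \<inter> space ?L = (\<Pi>\<^sub>E i\<in>{..<n}. (\<lambda>y. a i + c * y) -` X i)"
      by (auto simp: rn_def PiE_iff extensional_def)
    have m: "(\<lambda>y. a i + c * y) -` X i \<in> sets lborel" if "i < n" for i
      using measurable_sets[of "\<lambda>y. a i + c * y" lborel borel "X i"] X[of i] that by auto
    have sc: "emeasure lborel (X i) = ennreal c * emeasure lborel ((\<lambda>y. a i + c * y) -` X i)"
      if "i < n" for i
      using X[of i] that c
      by (subst lborel_real_affine[of c "a i"]) (simp_all add: emeasure_density nn_integral_cmult
           emeasure_distr nn_integral_distr)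
    have "emeasure (scale_measure (ennreal (c ^ n)) (distr ?L ?L ?T)) (Pi\<^sub>E {..<n} X)
        = ennreal (c ^ n) * emeasure ?L (\<Pi>\<^sub>E i\<in>{..<n}. (\<lambda>y. a i + c * y) -` X i)"
      using XL T by (simp add: emeasure_distr eq del: space_rn_lebesgue)
    also have "emeasure ?L (\<Pi>\<^sub>E i\<in>{..<n}. (\<lambda>y. a i + c * y) -` X i)
         = (\<Prod>i<n. emeasure lborel ((\<lambda>y. a i + c * y) -` X i))"
      unfolding rn_lebesgue_def using m by (intro emeasure_PiM) auto
    also have "ennreal (c ^ n) * \<dots> = (\<Prod>i<n. ennreal c * emeasure lborel ((\<lambda>y. a i + c * y) -` X i))"
      using c by (simp add: prod.distrib ennreal_power)
    also have "\<dots> = (\<Prod>i<n. emeasure lborel (X i))"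
      by (intro prod.cong) (auto simp: sc)
    finally show "emeasure (scale_measure (ennreal (c ^ n)) (distr ?L ?L ?T)) (Pi\<^sub>E {..<n} X)
      = (\<Prod>i\<in>{..<n}. emeasure lborel (X i))" .
  qed (auto simp: rn_lebesgue_def)
  then have "emeasure (scale_measure (ennreal (c ^ n)) (distr ?L ?L ?T)) A = emeasure ?L A"
    by (simp add: rn_lebesgue_def)
  moreover have "?T -` A \<inter> space ?L = {x \<in> rn n. ?T x \<in> A}"
    by auto
  ultimately show ?thesis
    using A T by (simp add: emeasure_distr del: space_rn_lebesgue)
qed

text \<open>The integrand is dominated by \<open>1 / l\<close> times the sum of the exponential
  density and its reflection, each of total mass 1. Only at 0 are both densities counted.\<close>

lemma nn_integral_exp_abs:
  assumes "l > 0"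
  shows "(\<integral>\<^sup>+x. ennreal (exp (- l * \<bar>x\<bar>)) \<partial>lborel) \<le> ennreal (2 / l)"
proof -
  have I: "(\<integral>\<^sup>+x. ennreal (exponential_density l x) \<partial>lborel) = 1"
    using prob_space.emeasure_space_1[OF prob_space_exponential_density[OF assms]]
    by (simp add: emeasure_density)
  have I': "(\<integral>\<^sup>+x. ennreal (exponential_density l (- x)) \<partial>lborel) = 1"
    using nn_integral_real_affine[of "\<lambda>x. ennreal (exponential_density l x)" "-1" 0] I by simp
  have "(\<integral>\<^sup>+x. ennreal (exp (- l * \<bar>x\<bar>)) \<partial>lborel)
     \<le> (\<integral>\<^sup>+x. ennreal (1 / l) * (ennreal (exponential_density l x) + ennreal (exponential_density l (- x))) \<partial>lborel)"
    using assms
    by (intro nn_integral_mono)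
       (auto simp: exponential_density_def ennreal_mult[symmetric] ennreal_plus[symmetric] field_simps
             simp del: ennreal_plus)
  also have "\<dots> = ennreal (1 / l) * (1 + 1)"
    by (subst nn_integral_cmult) (auto simp: nn_integral_add I I')
  also have "\<dots> = ennreal (1 / l * 2)"
    using assms by (subst ennreal_mult) auto
  finally show ?thesis using assms by simp
qed

section \<open>Volume and probability estimates\<close>

lemma mem_rn_ball: "x \<in> rn_ball n \<longleftrightarrow> x \<in> rn n \<and> (\<Sum>i<n. (x i)\<^sup>2) \<le> 1"
  by (auto simp: rn_ball_def L2_set_def)

lemma abs_le_1_rn_ball:
  assumes "x \<in> rn_ball n" "i < n"
  shows "\<bar>x i\<bar> \<le> 1"
proof -
  have "(x i)\<^sup>2 \<le> (\<Sum>i<n. (x i)\<^sup>2)"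
    using assms(2) by (intro member_le_sum) auto
  then have "\<bar>x i\<bar>\<^sup>2 \<le> 1\<^sup>2" using assms(1) by (simp add: mem_rn_ball)
  then show ?thesis by (rule power2_le_imp_le) simp
qed

text \<open>The ball lies between the cubes of half-side \<open>1 / sqrt n\<close> and 1. The inner
  cube has the right order of volume up to a factor exponential in \<open>n\<close>, which is all
  that the Chernoff bound can afford to lose.\<close>

lemma rn_ball_bounds:
  assumes n: "n > 0"
  shows "ennreal ((2 / sqrt (real n)) ^ n) \<le> emeasure (rn_lebesgue n) (rn_ball n)"
    and "emeasure (rn_lebesgue n) (rn_ball n) < \<infinity>"
proof -
  let ?L = "rn_lebesgue n" and ?a = "1 / sqrt (real n)"
  have "(\<Pi>\<^sub>E i\<in>{..<n}. {- ?a..?a}) \<subseteq> rn_ball n"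
  proof
    fix x assume x: "x \<in> (\<Pi>\<^sub>E i\<in>{..<n}. {- ?a..?a})"
    have "(x i)\<^sup>2 \<le> 1 / real n" if "i < n" for i
    proof -
      have "\<bar>x i\<bar> \<le> ?a" using PiE_mem[OF x, of i] that by (simp add: abs_le_iff)
      then have "\<bar>x i\<bar>\<^sup>2 \<le> ?a\<^sup>2" by (intro power_mono) auto
      then show ?thesis using n by (simp add: power_divide)
    qed
    then have "(\<Sum>i<n. (x i)\<^sup>2) \<le> (\<Sum>i<n. 1 / real n)" by (intro sum_mono) auto
    then have "(\<Sum>i<n. (x i)\<^sup>2) \<le> 1" using n by simp
    then show "x \<in> rn_ball n" using PiE_mono[of "{..<n}" _ "\<lambda>_. UNIV"] x
      by (auto simp: mem_rn_ball rn_def)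
  qed
  then have "emeasure ?L (\<Pi>\<^sub>E i\<in>{..<n}. {- ?a..?a}) \<le> emeasure ?L (rn_ball n)"
    by (intro emeasure_mono sets_rn_ball)
  moreover have "emeasure ?L (\<Pi>\<^sub>E i\<in>{..<n}. {- ?a..?a}) = ennreal ((2 / sqrt (real n)) ^ n)"
    by (subst emeasure_rn_box) auto
  ultimately show "ennreal ((2 / sqrt (real n)) ^ n) \<le> emeasure ?L (rn_ball n)" by simp
next
  let ?L = "rn_lebesgue n"
  have "rn_ball n \<subseteq> (\<Pi>\<^sub>E i\<in>{..<n}. {- 1..1})"
  proof
    fix x assume x: "x \<in> rn_ball n"
    have "x \<in> extensional {..<n}" using x by (simp add: mem_rn_ball rn_def PiE_def)
    show "x \<in> (\<Pi>\<^sub>E i\<in>{..<n}. {- 1..1})"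
    proof (rule PiE_I)
      fix i assume "i \<in> {..<n}"
      then show "x i \<in> {- 1..1}" using abs_le_1_rn_ball[OF x, of i] by (simp add: abs_le_iff)
    qed (use \<open>x \<in> extensional {..<n}\<close> in \<open>auto simp: extensional_def\<close>)
  qed
  then have "emeasure ?L (rn_ball n) \<le> emeasure ?L (\<Pi>\<^sub>E i\<in>{..<n}. {- 1..1})"
    by (intro emeasure_mono sets_rn_box)
  also have "\<dots> = ennreal (2 ^ n)" by (subst emeasure_rn_box) auto
  also have "\<dots> < \<infinity>" by simp
  finally show "emeasure ?L (rn_ball n) < \<infinity>" .
qed

lemma emeasure_rn_ball_nonzero:
  assumes "n > 0" shows "emeasure (rn_lebesgue n) (rn_ball n) \<noteq> 0"
proof -
  have "0 < ennreal ((2 / sqrt (real n)) ^ n)" using assms by simp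
  then show ?thesis using rn_ball_bounds(1)[OF assms] by auto
qed

text \<open>Chernoff's method: the indicator of the \<open>l\<^sub>1\<close> ball is at most
  \<open>e\<^sup>n \<Prod>\<^sub>i exp (- l \<bar>x\<^sub>i\<bar>)\<close> for \<open>l = \<surd>n / c\<close>; the Euclidean ball
  is compared with an inscribed cube.\<close>

lemma emeasure_l1_ball_le:
  assumes n: "n > 0" and c: "c > 0"
  shows "emeasure (rn_lebesgue n) {x \<in> rn n. (\<Sum>i<n. \<bar>x i\<bar>) \<le> c * sqrt (real n)}
           \<le> ennreal ((exp 1 * c) ^ n) * emeasure (rn_lebesgue n) (rn_ball n)"
proof -
  let ?L = "rn_lebesgue n"
  define l where "l = sqrt (real n) / c"
  have l: "l > 0" using n c by (simp add: l_def)
  let ?A = "{x \<in> rn n. (\<Sum>i<n. \<bar>x i\<bar>) \<le> c * sqrt (real n)}"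
  have "{x \<in> space ?L. (\<Sum>i<n. \<bar>x i\<bar>) \<le> c * sqrt (real n)} \<in> sets ?L" by measurable
  then have A: "?A \<in> sets ?L" by simp
  interpret product_sigma_finite "\<lambda>_. lborel :: real measure"
    by (rule product_sigma_finite_lborel)
  have ind: "indicator ?A x \<le> ennreal (exp (real n)) * (\<Prod>i<n. ennreal (exp (- l * \<bar>x i\<bar>)))" for x
  proof (cases "x \<in> ?A")
    case True
    have "l * (\<Sum>i<n. \<bar>x i\<bar>) \<le> l * (c * sqrt (real n))"
      using True l by (intro mult_left_mono) auto
    also have "\<dots> = real n" using c by (simp add: l_def)
    finally have "1 \<le> exp (real n - l * (\<Sum>i<n. \<bar>x i\<bar>))" by simp
    also have "\<dots> = exp (real n) * (\<Prod>i<n. exp (- l * \<bar>x i\<bar>))"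
      by (simp add: exp_sum[symmetric] exp_add[symmetric] sum_distrib_left sum_negf)
    finally have "ennreal 1 \<le> ennreal (exp (real n) * (\<Prod>i<n. exp (- l * \<bar>x i\<bar>)))"
      by (rule ennreal_leI)
    then show ?thesis using True by (simp add: ennreal_mult prod_ennreal prod_nonneg)
  qed simp
  have "emeasure ?L ?A = (\<integral>\<^sup>+x. indicator ?A x \<partial>?L)" using A by simp
  also have "\<dots> \<le> (\<integral>\<^sup>+x. ennreal (exp (real n)) * (\<Prod>i<n. ennreal (exp (- l * \<bar>x i\<bar>))) \<partial>?L)"
    by (intro nn_integral_mono ind)
  also have "\<dots> = ennreal (exp (real n)) * (\<integral>\<^sup>+x. (\<Prod>i<n. ennreal (exp (- l * \<bar>x i\<bar>))) \<partial>?L)"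
    by (intro nn_integral_cmult borel_measurable_prod_ennreal measurable_compose[OF _ measurable_ennreal]
          borel_measurable_exp[THEN measurable_compose[rotated]] borel_measurable_times
          borel_measurable_abs measurable_coordinate) auto
  also have "(\<integral>\<^sup>+x. (\<Prod>i<n. ennreal (exp (- l * \<bar>x i\<bar>))) \<partial>?L)
      = (\<Prod>i<n. \<integral>\<^sup>+x. ennreal (exp (- l * \<bar>x\<bar>)) \<partial>lborel)"
    unfolding rn_lebesgue_def by (rule product_nn_integral_prod) auto
  also have "\<dots> \<le> (\<Prod>i<n. ennreal (2 / l))"
    by (intro prod_mono_ennreal nn_integral_exp_abs l)
  also have "(\<Prod>i<n. ennreal (2 / l)) = ennreal ((2 / l) ^ n)"
    using l by (simp add: ennreal_power)
  finally have "emeasure ?L ?A \<le> ennreal (exp (real n)) * ennreal ((2 / l) ^ n)"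
    by (simp add: mult_left_mono)
  also have "\<dots> = ennreal (exp (real n) * (2 / l) ^ n)"
    using l by (simp add: ennreal_mult)
  \<comment> \<open>Since \<open>2 / l = c * (2 / sqrt n)\<close>, the volume of the inscribed cube
    splits off.\<close>
  also have "exp (real n) * (2 / l) ^ n = (exp 1 * c) ^ n * (2 / sqrt (real n)) ^ n"
    by (simp add: l_def power_mult_distrib power_divide exp_of_nat_mult[symmetric] field_simps)
  also have "ennreal \<dots> = ennreal ((exp 1 * c) ^ n) * ennreal ((2 / sqrt (real n)) ^ n)"
    using c by (intro ennreal_mult) auto
  also have "\<dots> \<le> ennreal ((exp 1 * c) ^ n) * emeasure ?L (rn_ball n)"
    by (intro mult_left_mono rn_ball_bounds n) auto
  finally show ?thesis .
qed

text \<open>Moving the cap \<open>{x \<in> ball. s < \<sigma> x\<^sub>i}\<close> by \<open>s\<close> towards the origin places it inside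
  the ball of radius \<open>\<surd>(1 - s\<^sup>2)\<close>.\<close>

lemma emeasure_cap_le:
  assumes i: "i < n" and s: "s \<ge> 0" and sg: "\<sigma> = 1 \<or> \<sigma> = (- 1 :: real)"
  shows "emeasure (rn_lebesgue n) {x \<in> rn_ball n. s < \<sigma> * x i}
           \<le> ennreal (exp (- real n * s\<^sup>2 / 2)) * emeasure (rn_lebesgue n) (rn_ball n)"
proof (cases "s < 1")
  case False
  have "\<not> s < \<sigma> * x i" if "x \<in> rn_ball n" for x
    using abs_le_1_rn_ball[OF that i] False sg by (elim disjE) (simp_all add: abs_le_iff)
  then have "{x \<in> rn_ball n. s < \<sigma> * x i} = {}" by blast
  then show ?thesis by (simp only: emeasure_empty zero_le)
next
  case True
  let ?L = "rn_lebesgue n"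
  define r where "r = sqrt (1 - s\<^sup>2)"
  have s2: "s\<^sup>2 < 1" using power_strict_mono[of s 1 2] True s by simp
  then have r: "r > 0" "r\<^sup>2 = 1 - s\<^sup>2" by (auto simp: r_def)
  \<comment> \<open>\<open>?T\<close> subtracts \<open>\<sigma> * s\<close> from coordinate
    \<open>i\<close> and divides by \<open>r\<close>, so it sends the ball of radius
    \<open>r\<close> around the centre of the moved cap to the unit ball.\<close>
  define a where "a = (\<lambda>j. if j = i then - \<sigma> * s / r else 0)"
  let ?T = "\<lambda>x. \<lambda>j\<in>{..<n}. a j + (1 / r) * x j"
  have sub: "{x \<in> rn_ball n. s < \<sigma> * x i} \<subseteq> {x \<in> rn n. ?T x \<in> rn_ball n}"
  proof safe
    fix x assume x: "x \<in> rn_ball n" and si: "s < \<sigma> * x i"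
    then show "x \<in> rn n" by (simp add: rn_ball_def)
    have x1: "(\<Sum>j<n. (x j)\<^sup>2) \<le> 1" using x by (simp add: rn_ball_def L2_set_def)
    have sgsq: "\<sigma>\<^sup>2 = 1" using sg by auto
    \<comment> \<open>The translation changes the squared norm by
      \<open>s^2 - 2 * s * (\<sigma> * x i)\<close>, which is at most \<open>- s^2\<close> on the
      cap. The new squared norm is therefore at most \<open>1 - s^2\<close>, the square of
      \<open>r\<close>.\<close>
    have "(\<Sum>j<n. (?T x j)\<^sup>2) = (\<Sum>j<n. (x j)\<^sup>2 / r\<^sup>2 + (if j = i then (s\<^sup>2 - 2 * s * (\<sigma> * x i)) / r\<^sup>2 else 0))"
    proof (intro sum.cong refl)
      fix j assume "j \<in> {..<n}"
      have "(- \<sigma> * s / r + x i / r)\<^sup>2 = (x i - \<sigma> * s)\<^sup>2 / r\<^sup>2"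
        unfolding power_divide[symmetric] by (rule arg_cong[where f = "\<lambda>u. u\<^sup>2"]) (simp add: diff_divide_distrib)
      also have "(x i - \<sigma> * s)\<^sup>2 = (x i)\<^sup>2 + (\<sigma>\<^sup>2 * s\<^sup>2 - 2 * s * (\<sigma> * x i))"
        by (simp add: power2_diff power_mult_distrib algebra_simps)
      finally show "(?T x j)\<^sup>2 = (x j)\<^sup>2 / r\<^sup>2 + (if j = i then (s\<^sup>2 - 2 * s * (\<sigma> * x i)) / r\<^sup>2 else 0)"
        using \<open>j \<in> {..<n}\<close> by (simp add: a_def power_divide sgsq add_divide_distrib)
    qed
    also have "\<dots> = ((\<Sum>j<n. (x j)\<^sup>2) + (s\<^sup>2 - 2 * s * (\<sigma> * x i))) / r\<^sup>2"
      using i by (simp add: sum.distrib sum_divide_distrib add_divide_distrib)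
    also have "\<dots> \<le> (1 - s\<^sup>2) / r\<^sup>2"
    proof (intro divide_right_mono)
      have "s * s \<le> s * (\<sigma> * x i)" using si s by (intro mult_left_mono) auto
      then show "(\<Sum>j<n. (x j)\<^sup>2) + (s\<^sup>2 - 2 * s * (\<sigma> * x i)) \<le> 1 - s\<^sup>2"
        using x1 by (simp add: power2_eq_square)
    qed simp
    also have "\<dots> = 1" using r by (metis divide_self_if less_numeral_extra(3) zero_less_power)
    finally show "?T x \<in> rn_ball n"
      by (simp add: rn_ball_def rn_def L2_set_def)
  qed
  have "?T \<in> measurable ?L ?L"
    by (intro measurable_into_rn borel_measurable_add borel_measurable_times measurable_coordinate) auto
  then have "?T -` rn_ball n \<inter> space ?L \<in> sets ?L" using sets_rn_ball by (rule measurable_sets)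
  also have "?T -` rn_ball n \<inter> space ?L = {x \<in> rn n. ?T x \<in> rn_ball n}" by auto
  finally have "emeasure ?L {x \<in> rn_ball n. s < \<sigma> * x i} \<le> emeasure ?L {x \<in> rn n. ?T x \<in> rn_ball n}"
    by (intro emeasure_mono sub)
  \<comment> \<open>Inserting \<open>r ^ n * (1 / r) ^ n = 1\<close> prepares the affine rule with
    \<open>c = 1 / r\<close>.\<close>
  also have "\<dots> = ennreal (r ^ n) * (ennreal ((1 / r) ^ n) * emeasure ?L {x \<in> rn n. ?T x \<in> rn_ball n})"
  proof -
    have "ennreal (r ^ n) * ennreal ((1 / r) ^ n) = 1"
      using r by (subst ennreal_mult[symmetric]) (auto simp: power_divide)
    then show ?thesis by (simp only: mult.assoc[symmetric] mult_1_left)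
  qed
  also have "\<dots> = ennreal (r ^ n) * emeasure ?L (rn_ball n)"
    using r by (subst emeasure_rn_affine) (auto intro: sets_rn_ball)
  also have "\<dots> \<le> ennreal (exp (- real n * s\<^sup>2 / 2)) * emeasure ?L (rn_ball n)"
  proof (intro mult_right_mono ennreal_leI)
    \<comment> \<open>This is \<open>1 + y \<le> exp y\<close> at \<open>y = - s^2\<close>; its
      square root is then raised to the power \<open>n\<close>.\<close>
    have "r\<^sup>2 \<le> exp (- s\<^sup>2)" using exp_ge_add_one_self[of "- s\<^sup>2"] r by simp
    also have "\<dots> = (exp (- s\<^sup>2 / 2))\<^sup>2" by (simp add: power2_eq_square exp_add[symmetric])
    finally have "r \<le> exp (- s\<^sup>2 / 2)" by (rule power2_le_imp_le) simp
    then have "r ^ n \<le> exp (- s\<^sup>2 / 2) ^ n" using r by (intro power_mono) auto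
    then show "r ^ n \<le> exp (- real n * s\<^sup>2 / 2)" by (simp add: exp_of_nat_mult[symmetric])
  qed simp
  finally show ?thesis .
qed

section \<open>Uniform distributions on the ball and the sphere, and their tails\<close>

definition ball_uniform :: "nat \<Rightarrow> (nat \<Rightarrow> real) measure" where
  "ball_uniform n = uniform_measure (rn_lebesgue n) (rn_ball n)"

lemma space_ball_uniform [simp]: "space (ball_uniform n) = rn n"
  and sets_ball_uniform [simp, measurable_cong]: "sets (ball_uniform n) = sets (rn_lebesgue n)"
  by (auto simp: ball_uniform_def)

lemma prob_space_ball_uniform: "n > 0 \<Longrightarrow> prob_space (ball_uniform n)"
  unfolding ball_uniform_def
  using rn_ball_bounds(2)[of n] emeasure_rn_ball_nonzero[of n]
  by (intro prob_space_uniform_measure) auto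

lemma measure_ball_uniform_le:
  assumes n: "n > 0" and A: "A \<in> sets (rn_lebesgue n)" and r: "r \<ge> 0"
    and le: "emeasure (rn_lebesgue n) (rn_ball n \<inter> A) \<le> ennreal r * emeasure (rn_lebesgue n) (rn_ball n)"
  shows "measure (ball_uniform n) A \<le> r"
proof -
  let ?B = "emeasure (rn_lebesgue n) (rn_ball n)"
  have "emeasure (ball_uniform n) A = emeasure (rn_lebesgue n) (rn_ball n \<inter> A) / ?B"
    using A by (simp add: ball_uniform_def sets_rn_ball)
  also have "\<dots> \<le> ennreal r * ?B / ?B" by (intro divide_right_mono_ennreal le)
  also have "\<dots> = ennreal r"
    using rn_ball_bounds(2)[OF n] emeasure_rn_ball_nonzero[OF n]
    by (subst ennreal_mult_divide_eq) auto
  finally show ?thesis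
    using prob_space_ball_uniform[OF n, THEN prob_space.finite_measure] r
    by (simp add: finite_measure.emeasure_eq_measure)
qed

lemma space_sphere_uniform [simp]: "space (sphere_uniform n) = rn n"
  and sets_sphere_uniform [simp, measurable_cong]: "sets (sphere_uniform n) = sets (rn_lebesgue n)"
  by (auto simp: sphere_uniform_def)

lemma sphere_uniform_eq: "sphere_uniform n = distr (ball_uniform n) (rn_lebesgue n) (normalize_vec n)"
  by (simp add: sphere_uniform_def ball_uniform_def)

lemma measurable_normalize_vec' [measurable]:
  "normalize_vec n \<in> measurable (ball_uniform n) (rn_lebesgue n)"
  using measurable_normalize_vec measurable_cong_sets[OF sets_ball_uniform refl] by blast

lemma prob_space_sphere_uniform: "n > 0 \<Longrightarrow> prob_space (sphere_uniform n)"
  unfolding sphere_uniform_eq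
  by (intro prob_space.prob_space_distr prob_space_ball_uniform measurable_normalize_vec')

lemma normalize_vec_in_rn [simp]: "normalize_vec n x \<in> rn n"
  by (simp add: normalize_vec_def rn_def)

lemma measure_sphere_uniform:
  assumes "{x \<in> rn n. Q x} \<in> sets (rn_lebesgue n)"
  shows "measure (sphere_uniform n) {x \<in> rn n. Q x}
       = measure (ball_uniform n) {x \<in> rn n. Q (normalize_vec n x)}"
proof -
  have "normalize_vec n -` {x \<in> rn n. Q x} \<inter> space (ball_uniform n) = {x \<in> rn n. Q (normalize_vec n x)}"
    by auto
  then show ?thesis unfolding sphere_uniform_eq using assms
    by (subst measure_distr) (auto simp: measurable_normalize_vec')
qed

lemma sets_normalize_vec:
  assumes "{x \<in> rn n. Q x} \<in> sets (rn_lebesgue n)"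
  shows "{x \<in> rn n. Q (normalize_vec n x)} \<in> sets (rn_lebesgue n)"
proof -
  have "normalize_vec n -` {x \<in> rn n. Q x} \<inter> space (rn_lebesgue n) = {x \<in> rn n. Q (normalize_vec n x)}"
    by auto
  then show ?thesis using measurable_sets[OF measurable_normalize_vec assms] by metis
qed

lemma measure_ball_l1_le:
  assumes n: "n > 0" and c: "c > 0"
  shows "measure (ball_uniform n) {x \<in> rn n. (\<Sum>i<n. \<bar>x i\<bar>) \<le> c * sqrt (real n)} \<le> (exp 1 * c) ^ n"
proof -
  let ?A = "{x \<in> rn n. (\<Sum>i<n. \<bar>x i\<bar>) \<le> c * sqrt (real n)}"
  have "{x \<in> space (rn_lebesgue n). (\<Sum>i<n. \<bar>x i\<bar>) \<le> c * sqrt (real n)} \<in> sets (rn_lebesgue n)" by measurable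
  then have A: "?A \<in> sets (rn_lebesgue n)" by simp
  have "emeasure (rn_lebesgue n) (rn_ball n \<inter> ?A) \<le> emeasure (rn_lebesgue n) ?A"
    using A by (intro emeasure_mono) auto
  also note emeasure_l1_ball_le[OF n c]
  finally show ?thesis using c by (intro measure_ball_uniform_le n A) auto
qed

lemma L2_set_eq_0_rn: "L2_set x {..<n} = 0 \<longleftrightarrow> (\<forall>i<n. x i = 0)" for n :: nat
  by (auto simp: L2_set_eq_0_iff)

lemma sum_abs_normalize_vec:
  "(\<Sum>i<n. \<bar>normalize_vec n x i\<bar>) = (\<Sum>i<n. \<bar>x i\<bar>) / L2_set x {..<n}"
  by (simp add: normalize_vec_def sum_divide_distrib abs_divide L2_set_nonneg)

text \<open>The law before normalization is concentrated on the ball, where dividing by the norm can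
  only increase the l1 norm. So the event for the normalized point implies the event for the point
  itself, and the ball estimate applies.\<close>

lemma measure_sphere_l1_le:
  assumes n: "n > 0" and c: "c > 0"
  shows "measure (sphere_uniform n) {x \<in> rn n. (\<Sum>i<n. \<bar>x i\<bar>) \<le> c * sqrt (real n)} \<le> (exp 1 * c) ^ n"
proof -
  let ?Q = "\<lambda>x. (\<Sum>i<n. \<bar>x i\<bar>) \<le> c * sqrt (real n)"
  interpret prob_space "ball_uniform n" using prob_space_ball_uniform[OF n] .
  have "{x \<in> space (rn_lebesgue n). ?Q x} \<in> sets (rn_lebesgue n)" by measurable
  then have A: "{x \<in> rn n. ?Q x} \<in> sets (rn_lebesgue n)" by simp
  have "measure (sphere_uniform n) {x \<in> rn n. ?Q x} = prob {x \<in> rn n. ?Q (normalize_vec n x)}"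
    by (rule measure_sphere_uniform[OF A])
  also have "\<dots> = prob ({x \<in> rn n. ?Q (normalize_vec n x)} \<inter> rn_ball n)"
  proof -
    have "emeasure (ball_uniform n) X = emeasure (ball_uniform n) (X \<inter> rn_ball n)"
      if "X \<in> sets (rn_lebesgue n)" for X
    proof -
      have "rn_ball n \<inter> (X \<inter> rn_ball n) = rn_ball n \<inter> X" by blast
      then show ?thesis
        unfolding ball_uniform_def
        by (simp only: emeasure_uniform_measure that sets_rn_ball sets.Int)
    qed
    from this[OF sets_normalize_vec[OF A]] show ?thesis by (simp only: measure_def)
  qed
  also have "\<dots> \<le> prob {x \<in> rn n. ?Q x}"
  proof (intro finite_measure_mono)
    show "{x \<in> rn n. ?Q (normalize_vec n x)} \<inter> rn_ball n \<subseteq> {x \<in> rn n. ?Q x}"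
    proof safe
      fix x assume Q: "?Q (normalize_vec n x)" and x: "x \<in> rn_ball n"
      show "?Q x"
      proof (cases "L2_set x {..<n} = 0")
        \<comment> \<open>At the origin the normalization divides by zero, but the point itself
          vanishes.\<close>
        case True
        then show ?thesis using c by (simp add: L2_set_eq_0_rn)
      next
        case False
        then have p: "L2_set x {..<n} > 0" using L2_set_nonneg[of x "{..<n}"] by linarith
        then have "(\<Sum>i<n. \<bar>x i\<bar>) \<le> c * sqrt (real n) * L2_set x {..<n}"
          using Q by (simp add: sum_abs_normalize_vec divide_le_eq)
        also have "\<dots> \<le> c * sqrt (real n) * 1"
          using x c by (intro mult_left_mono) (auto simp: rn_ball_def)
        finally show ?thesis by simp
      qed
    qed
  qed (use A in simp)
  also have "\<dots> \<le> (exp 1 * c) ^ n" by (rule measure_ball_l1_le[OF n c])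
  finally show ?thesis .
qed

lemma l1_le_L2:
  assumes "finite S"
  shows "(\<Sum>i\<in>S. \<bar>x i\<bar>) \<le> sqrt (real (card S)) * L2_set x S"
  using L2_set_mult_ineq[of x "\<lambda>_. 1" S] by (simp add: L2_set_def mult.commute)

text \<open>Let \<open>x\<close> be the point before normalization. If its norm is at most
  \<open>r\<close>, then by Cauchy-Schwarz its l1 norm is at most \<open>r * sqrt n\<close>, which
  has small probability. Otherwise a large normalized coordinate forces
  \<open>\<bar>x i\<bar> > t * r\<close>, so \<open>x\<close> lies in one of \<open>2 * n\<close>
  caps, and a union bound applies.\<close>

lemma measure_sphere_linf_le:
  assumes n: "n > 0" and r: "r > 0" and t: "t \<ge> 0"
  shows "measure (sphere_uniform n) {x \<in> rn n. \<exists>i<n. t < \<bar>x i\<bar>}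
           \<le> (exp 1 * r) ^ n + 2 * real n * exp (- real n * (t * r)\<^sup>2 / 2)"
proof -
  let ?L = "rn_lebesgue n"
  let ?Q = "\<lambda>x. \<exists>i<n. t < \<bar>x i\<bar>"
  let ?e = "exp (- real n * (t * r)\<^sup>2 / 2)"
  interpret prob_space "ball_uniform n" using prob_space_ball_uniform[OF n] .
  define C where "C = (\<lambda>\<sigma> i. {x \<in> rn n. t * r < \<sigma> * x i})"
  define D where "D = {x \<in> rn n. (\<Sum>i<n. \<bar>x i\<bar>) \<le> r * sqrt (real n)}"
  have C: "C \<sigma> i \<in> sets ?L" if "i < n" for \<sigma> i
  proof -
    have [measurable]: "(\<lambda>x. x i) \<in> borel_measurable ?L" using that by (rule measurable_coordinate)
    have "{x \<in> space ?L. t * r < \<sigma> * x i} \<in> sets ?L" by measurable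
    then show ?thesis by (simp add: C_def)
  qed
  have "{x \<in> space ?L. (\<Sum>i<n. \<bar>x i\<bar>) \<le> r * sqrt (real n)} \<in> sets ?L" by measurable
  then have D: "D \<in> sets ?L" by (simp add: D_def)
  note Q = sets_linf_rn[of n t]
  have pC: "prob (C \<sigma> i) \<le> ?e" if "i < n" "\<sigma> = 1 \<or> \<sigma> = -1" for \<sigma> i
  proof (intro measure_ball_uniform_le n C that(1))
    have "rn_ball n \<inter> C \<sigma> i = {x \<in> rn_ball n. t * r < \<sigma> * x i}"
      by (auto simp: C_def rn_ball_def)
    then show "emeasure ?L (rn_ball n \<inter> C \<sigma> i) \<le> ennreal ?e * emeasure ?L (rn_ball n)"
      using emeasure_cap_le[of i n "t * r" \<sigma>] that r t by simp
  qed simp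
  have "measure (sphere_uniform n) {x \<in> rn n. ?Q x} = prob {x \<in> rn n. ?Q (normalize_vec n x)}"
    by (rule measure_sphere_uniform[OF Q])
  also have "\<dots> \<le> prob (D \<union> ((\<Union>i<n. C 1 i) \<union> (\<Union>i<n. C (- 1) i)))"
  proof (intro finite_measure_mono)
    show "{x \<in> rn n. ?Q (normalize_vec n x)} \<subseteq> D \<union> ((\<Union>i<n. C 1 i) \<union> (\<Union>i<n. C (- 1) i))"
    proof
      fix x assume "x \<in> {x \<in> rn n. ?Q (normalize_vec n x)}"
      then obtain i where x: "x \<in> rn n" and i: "i < n" and "t < \<bar>normalize_vec n x i\<bar>" by blast
      then have ti: "t < \<bar>x i\<bar> / L2_set x {..<n}"
        by (simp add: normalize_vec_def abs_divide L2_set_nonneg)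
      show "x \<in> D \<union> ((\<Union>i<n. C 1 i) \<union> (\<Union>i<n. C (- 1) i))"
      proof (cases "L2_set x {..<n} \<le> r")
        case True
        have "(\<Sum>i<n. \<bar>x i\<bar>) \<le> sqrt (real n) * L2_set x {..<n}" using l1_le_L2[of "{..<n}" x] by simp
        also have "\<dots> \<le> sqrt (real n) * r" by (intro mult_left_mono True) auto
        finally show ?thesis using x by (simp add: D_def mult.commute)
      next
        case False
        have "t * r \<le> t * L2_set x {..<n}" using False t by (intro mult_left_mono) auto
        also have "\<dots> < \<bar>x i\<bar>" using ti False r by (simp add: less_divide_eq)
        finally have "t * r < 1 * x i \<or> t * r < (-1) * x i" by linarith
        then have "x \<in> C 1 i \<or> x \<in> C (-1) i" using x by (auto simp: C_def)
        then show ?thesis using i by blast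
      qed
    qed
  qed (use C D in auto)
  also have "\<dots> \<le> prob D + (prob (\<Union>i<n. C 1 i) + prob (\<Union>i<n. C (- 1) i))"
    using C D by (intro order_trans[OF measure_Un_le] add_left_mono
                    measure_Un_le) auto
  also have "\<dots> \<le> prob D + ((\<Sum>i<n. prob (C 1 i)) + (\<Sum>i<n. prob (C (- 1) i)))"
    using C by (intro add_left_mono add_mono finite_measure_subadditive_finite) auto
  also have "\<dots> \<le> (exp 1 * r) ^ n + ((\<Sum>i<n. ?e) + (\<Sum>i<n. ?e))"
    unfolding D_def by (intro add_mono measure_ball_l1_le n r sum_mono pC) auto
  finally show ?thesis by simp
qed

section \<open>Medians\<close>

text \<open>The infimum of the points where the distribution function reaches one half is a median:
  right continuity gives one inequality, the left limit gives the other.\<close>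

lemma is_median_exists:
  assumes "prob_space P" and f [measurable]: "f \<in> borel_measurable P"
  shows "\<exists>m. is_median P f m"
proof -
  interpret prob_space P by fact
  interpret D: real_distribution "distr P borel f"
    by (intro real_distribution_distr f)
  let ?D = "distr P borel f"
  define S where "S = {x. cdf ?D x \<ge> 1 / 2}"
  have "eventually (\<lambda>x. 1 / 2 < cdf ?D x) at_top"
    by (rule order_tendstoD(1)[OF D.cdf_lim_at_top_prob]) simp
  then have "\<exists>x. 1 / 2 < cdf ?D x"
    using eventually_happens trivial_limit_at_top_linorder by blast
  then have ne: "S \<noteq> {}" by (auto simp: S_def intro: less_imp_le)
  have "eventually (\<lambda>x. cdf ?D x < 1 / 2) at_bot"
    by (rule order_tendstoD(2)[OF D.cdf_lim_at_bot]) simp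
  then obtain b where b: "\<And>x. x \<le> b \<Longrightarrow> cdf ?D x < 1 / 2"
    unfolding eventually_at_bot_linorder by blast
  have bdd: "bdd_below S"
  proof (rule bdd_belowI)
    fix x assume "x \<in> S"
    then show "b \<le> x" using b[of x] by (force simp: S_def)
  qed
  define m where "m = Inf S"
  have right: "1 / 2 \<le> cdf ?D x" if mx: "m < x" for x
  proof -
    obtain s where "s \<in> S" "s < x"
      using cInf_less_iff[OF ne bdd, of x] mx unfolding m_def by blast
    then show ?thesis using D.cdf_nondecreasing[of s x] by (auto simp: S_def)
  qed
  have left: "cdf ?D x \<le> 1 / 2" if "x < m" for x
  proof (rule ccontr)
    assume "\<not> ?thesis"
    then have "x \<in> S" by (simp add: S_def)
    then show False using cInf_lower[OF _ bdd, of x] that by (simp add: m_def)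
  qed
  have ev: "\<forall>\<^sub>F x in at_right m. 1 / 2 \<le> cdf ?D x"
    using eventually_at_right_less[of m] by (rule eventually_mono) (rule right)
  have "((cdf ?D) \<longlongrightarrow> cdf ?D m) (at_right m)"
    using D.cdf_is_right_cont[of m] by (simp add: continuous_within)
  then have "1 / 2 \<le> cdf ?D m"
    by (rule tendsto_lowerbound[OF _ ev]) simp
  then have 1: "1 / 2 \<le> prob {x \<in> space P. f x \<le> m}"
    by (simp add: cdf_def measure_distr vimage_def Int_def conj_commute)
  have ev': "\<forall>\<^sub>F x in at_left m. cdf ?D x \<le> 1 / 2"
    unfolding eventually_at_filter by (intro always_eventually allI impI left) simp
  have "measure ?D {..<m} \<le> 1 / 2"
    by (rule tendsto_upperbound[OF D.cdf_at_left[of m] ev']) simp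
  then have "prob {x \<in> space P. f x < m} \<le> 1 / 2"
    by (simp add: measure_distr vimage_def Int_def conj_commute)
  moreover have "prob {x \<in> space P. f x \<ge> m} = 1 - prob {x \<in> space P. f x < m}"
    using prob_neg[of "\<lambda>x. f x < m"] by (simp add: not_less)
  ultimately show ?thesis using 1 by (auto simp: is_median_def)
qed

text \<open>If \<open>m < a\<close>, the lower event at \<open>m\<close>, of probability at least
  one half, would be contained in the event at \<open>a\<close>.\<close>

lemma is_median_ge:
  assumes "prob_space P" "f \<in> borel_measurable P" "is_median P f m"
    and "measure P {x \<in> space P. f x \<le> a} < 1 / 2"
  shows "a \<le> m"
proof (rule ccontr)
  assume "\<not> a \<le> m"
  interpret prob_space P by fact
  have "prob {x \<in> space P. f x \<le> m} \<le> prob {x \<in> space P. f x \<le> a}"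
    using \<open>\<not> a \<le> m\<close> assms(2) by (intro finite_measure_mono) auto
  then show False using assms(3,4) by (simp add: is_median_def)
qed

lemma is_median_le:
  assumes "prob_space P" "f \<in> borel_measurable P" "is_median P f m"
    and "measure P {x \<in> space P. b < f x} < 1 / 2"
  shows "m \<le> b"
proof (rule ccontr)
  assume "\<not> m \<le> b"
  interpret prob_space P by fact
  have "prob {x \<in> space P. f x \<ge> m} \<le> prob {x \<in> space P. b < f x}"
    using \<open>\<not> m \<le> b\<close> assms(2) by (intro finite_measure_mono) auto
  then show False using assms(3,4) by (simp add: is_median_def)
qed

section \<open>Homogeneous Lipschitz functions on the sphere and their unique medians\<close>

lemma L2_set_scale: "L2_set (\<lambda>i. c * x i) S = \<bar>c\<bar> * L2_set x S"
  by (simp add: L2_set_def power_mult_distrib sum_distrib_left[symmetric] real_sqrt_mult)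

lemma L2_set_diff_le:
  assumes "finite S"
  shows "\<bar>L2_set x S - L2_set y S\<bar> \<le> (\<Sum>i\<in>S. \<bar>x i - y i\<bar>)"
proof -
  have *: "L2_set x S \<le> L2_set y S + (\<Sum>i\<in>S. \<bar>x i - y i\<bar>)" for x y
    using L2_set_triangle_ineq[of y "\<lambda>i. x i - y i" S] L2_set_le_sum_abs[of "\<lambda>i. x i - y i" S] by simp
  show ?thesis using *[of x y] *[of y x] by (simp add: abs_minus_commute abs_le_iff)
qed

text \<open>With \<open>c = 1 / 9\<close> and \<open>e \<le> 3\<close> the base \<open>e * c\<close>
  is at most \<open>1 / 3\<close>, so every power with \<open>n \<ge> 1\<close> is below one half.
  The ball version serves to avoid the origin when a unit vector has to be produced.\<close>

lemma measure_sphere_l1_lt_half: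
  assumes "n > 0"
  shows "measure (sphere_uniform n) {x \<in> rn n. (\<Sum>i<n. \<bar>x i\<bar>) \<le> sqrt (real n) / 9} < 1 / 2"
    and "measure (ball_uniform n) {x \<in> rn n. (\<Sum>i<n. \<bar>x i\<bar>) \<le> sqrt (real n) / 9} < 1 / 2"
proof -
  have "(exp 1 * (1 / 9 :: real)) ^ n \<le> (1 / 3) ^ n"
    using exp_le by (intro power_mono) auto
  also have "\<dots> \<le> (1 / 3) ^ 1" using assms by (intro power_decreasing) auto
  finally have "(exp 1 * (1 / 9 :: real)) ^ n < 1 / 2" by simp
  then show "measure (sphere_uniform n) {x \<in> rn n. (\<Sum>i<n. \<bar>x i\<bar>) \<le> sqrt (real n) / 9} < 1 / 2"
    and "measure (ball_uniform n) {x \<in> rn n. (\<Sum>i<n. \<bar>x i\<bar>) \<le> sqrt (real n) / 9} < 1 / 2"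
    using measure_sphere_l1_le[OF assms, of "1 / 9"] measure_ball_l1_le[OF assms, of "1 / 9"]
    by simp_all
qed

lemma normalize_vec_in_sphere:
  assumes "L2_set x {..<n} \<noteq> 0"
  shows "normalize_vec n x \<in> rn_sphere n"
proof -
  have "L2_set (normalize_vec n x) {..<n} = L2_set (\<lambda>i. (1 / L2_set x {..<n}) * x i) {..<n}"
    by (intro L2_set_cong) (auto simp: normalize_vec_def)
  also have "\<dots> = 1" using assms L2_set_nonneg[of x "{..<n}"] by (simp only: L2_set_scale) simp
  finally show ?thesis by (simp add: rn_sphere_def)
qed

text \<open>The law is a measure on all of \<open>rn n\<close>, so a likely event must still be
  shown to meet the sphere. Its preimage under normalization is too large to fit into the region of
  small l1 norm, hence contains a nonzero point.\<close>

lemma sphere_uniform_witness: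
  assumes n: "n > 0" and A: "{x \<in> rn n. Q x} \<in> sets (rn_lebesgue n)"
    and p: "measure (sphere_uniform n) {x \<in> rn n. Q x} \<ge> 1 / 2"
  obtains u where "u \<in> rn_sphere n" "Q u"
proof -
  interpret prob_space "ball_uniform n" using prob_space_ball_uniform[OF n] .
  let ?D = "{x \<in> rn n. (\<Sum>i<n. \<bar>x i\<bar>) \<le> sqrt (real n) / 9}"
  have "{x \<in> space (rn_lebesgue n). (\<Sum>i<n. \<bar>x i\<bar>) \<le> sqrt (real n) / 9} \<in> sets (rn_lebesgue n)"
    by measurable
  then have D: "?D \<in> sets (rn_lebesgue n)" by simp
  have "\<not> {x \<in> rn n. Q (normalize_vec n x)} \<subseteq> ?D"
  proof
    assume "{x \<in> rn n. Q (normalize_vec n x)} \<subseteq> ?D"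
    then have "prob {x \<in> rn n. Q (normalize_vec n x)} \<le> prob ?D"
      using D by (intro finite_measure_mono) auto
    then show False
      using p measure_sphere_l1_lt_half(2)[OF n] measure_sphere_uniform[OF A] by linarith
  qed
  then obtain x where x: "x \<in> rn n" "Q (normalize_vec n x)" "\<not> (\<Sum>i<n. \<bar>x i\<bar>) \<le> sqrt (real n) / 9"
    by blast
  have "L2_set x {..<n} \<noteq> 0"
  proof
    assume "L2_set x {..<n} = 0"
    then have "(\<Sum>i<n. \<bar>x i\<bar>) = 0" by (simp add: L2_set_eq_0_rn)
    with x(3) show False by simp
  qed
  then show ?thesis using that normalize_vec_in_sphere x(2) by blast
qed

text \<open>These are the properties of a norm from which uniqueness of the median follows. As
  \<open>f\<close> takes arbitrary functions on the naturals, the Lipschitz condition also says that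
  only the coordinates below \<open>n\<close> matter.\<close>

locale lipschitz_homogeneous =
  fixes n :: nat and f :: "(nat \<Rightarrow> real) \<Rightarrow> real" and L :: real
  assumes n: "n > 0"
    and measurable_f: "f \<in> borel_measurable (rn_lebesgue n)"
    and homogeneous: "f (\<lambda>i. c * x i) = \<bar>c\<bar> * f x"
    and lipschitz: "\<bar>f x - f y\<bar> \<le> L * (\<Sum>i<n. \<bar>x i - y i\<bar>)"
begin

lemma f_cong: "(\<And>i. i < n \<Longrightarrow> x i = y i) \<Longrightarrow> f x = f y"
  using lipschitz[of x y] by simp

lemma f_normalize_vec: "f (normalize_vec n x) = f x / L2_set x {..<n}"
proof -
  have "f (normalize_vec n x) = f (\<lambda>i. (1 / L2_set x {..<n}) * x i)"
    by (rule f_cong) (simp add: normalize_vec_def)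
  also have "\<dots> = f x / L2_set x {..<n}"
    by (simp only: homogeneous) (simp add: L2_set_nonneg)
  finally show ?thesis .
qed

lemma L_nonneg: "L \<ge> 0"
proof -
  have "0 \<le> \<bar>f (\<lambda>i. if i = 0 then 1 else 0) - f (\<lambda>i. 0)\<bar>" by simp
  also have "\<dots> \<le> L * (\<Sum>i<n. \<bar>(if i = 0 then 1 else 0) - 0\<bar>)" by (rule lipschitz)
  also have "(\<Sum>i<n. \<bar>(if i = 0 then 1 else 0) - 0 :: real\<bar>) = (\<Sum>i<n. if i = 0 then 1 else 0)"
    by (intro sum.cong) auto
  also have "\<dots> = 1" using n by simp
  finally show ?thesis by simp
qed

lemma sets_f:
  "{x \<in> rn n. f x \<le> a} \<in> sets (rn_lebesgue n)" "{x \<in> rn n. a \<le> f x} \<in> sets (rn_lebesgue n)"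
  "{x \<in> rn n. a < f x \<and> f x < b} \<in> sets (rn_lebesgue n)"
proof -
  note measurable_f [measurable]
  have "{x \<in> space (rn_lebesgue n). f x \<le> a} \<in> sets (rn_lebesgue n)"
    "{x \<in> space (rn_lebesgue n). a \<le> f x} \<in> sets (rn_lebesgue n)"
    "{x \<in> space (rn_lebesgue n). a < f x \<and> f x < b} \<in> sets (rn_lebesgue n)"
    by measurable
  then show "{x \<in> rn n. f x \<le> a} \<in> sets (rn_lebesgue n)"
    "{x \<in> rn n. a \<le> f x} \<in> sets (rn_lebesgue n)"
    "{x \<in> rn n. a < f x \<and> f x < b} \<in> sets (rn_lebesgue n)"
    by simp_all
qed

lemma measurable_f_sphere: "f \<in> borel_measurable (sphere_uniform n)"
  using measurable_f measurable_cong_sets[OF sets_sphere_uniform refl] by blast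

text \<open>Intermediate values are found on the segment between two unit vectors. It avoids the origin
  because antipodal points have equal values.\<close>

lemma intermediate_value:
  assumes u: "u \<in> rn_sphere n" and v: "v \<in> rn_sphere n" and "f u < y" "y < f v"
  obtains z where "L2_set z {..<n} \<noteq> 0" "f z / L2_set z {..<n} = y"
proof -
  define h where "h = (\<lambda>t i. (1 - t) * u i + t * v i)"
  have nu: "L2_set u {..<n} = 1" and nv: "L2_set v {..<n} = 1"
    using u v by (auto simp: rn_sphere_def)
  have nz: "L2_set (h t) {..<n} \<noteq> 0" for t
  proof
    assume "L2_set (h t) {..<n} = 0"
    then have eq: "(1 - t) * u i = (- t) * v i" if "i < n" for i
      using that by (auto simp: L2_set_eq_0_rn h_def eq_neg_iff_add_eq_0)
    have "L2_set (\<lambda>i. (1 - t) * u i) {..<n} = L2_set (\<lambda>i. (- t) * v i) {..<n}"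
      by (intro L2_set_cong) (auto simp: eq)
    then have t: "\<bar>1 - t\<bar> = \<bar>t\<bar>" by (simp only: L2_set_scale nu nv) simp
    \<comment> \<open>As \<open>\<bar>1 - t\<bar> = \<bar>t\<bar>\<close>, homogeneity and
      \<open>f u < f v\<close> leave only \<open>t = 0\<close>, which contradicts that
      equation.\<close>
    have "f (\<lambda>i. (1 - t) * u i) = f (\<lambda>i. (- t) * v i)"
      by (intro f_cong eq)
    then have "\<bar>1 - t\<bar> * f u = \<bar>t\<bar> * f v" by (simp only: homogeneous) simp
    then have "t = 0" using t assms(3,4) by auto
    then show False using t by simp
  qed
  have "continuous_on {0..1} (\<lambda>t. f (h t))"
  proof (rule lipschitz_on_continuous_on)
    show "(L * (\<Sum>i<n. \<bar>v i - u i\<bar>))-lipschitz_on {0..1} (\<lambda>t. f (h t))"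
    proof (rule lipschitz_onI)
      fix s t :: real
      have "\<bar>f (h s) - f (h t)\<bar> \<le> L * (\<Sum>i<n. \<bar>h s i - h t i\<bar>)" by (rule lipschitz)
      also have "(\<Sum>i<n. \<bar>h s i - h t i\<bar>) = (\<Sum>i<n. \<bar>s - t\<bar> * \<bar>v i - u i\<bar>)"
        unfolding abs_mult[symmetric] by (intro sum.cong refl arg_cong[where f = abs]) (simp add: h_def algebra_simps)
      finally show "dist (f (h s)) (f (h t)) \<le> L * (\<Sum>i<n. \<bar>v i - u i\<bar>) * dist s t"
        by (simp add: dist_real_def sum_distrib_left[symmetric] mult_ac)
    qed (auto intro!: mult_nonneg_nonneg L_nonneg sum_nonneg)
  qed
  moreover have "continuous_on {0..1} (\<lambda>t. L2_set (h t) {..<n})"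
    unfolding L2_set_def h_def by (intro continuous_intros)
  ultimately have "continuous_on {0..1} (\<lambda>t. f (h t) / L2_set (h t) {..<n})"
    by (intro continuous_on_divide) (auto simp: nz)
  moreover have "f (h 0) / L2_set (h 0) {..<n} = f u" "f (h 1) / L2_set (h 1) {..<n} = f v"
    using nu nv by (auto simp: h_def)
  ultimately obtain t where "f (h t) / L2_set (h t) {..<n} = y"
    using IVT'[of "\<lambda>t. f (h t) / L2_set (h t) {..<n}" 0 y 1] assms(3,4) by auto
  then show ?thesis using that[of "h t"] nz by blast
qed

text \<open>A small cube around a multiple of \<open>z\<close> inside the ball has positive volume,
  and by the Lipschitz condition all its points have normalized values strictly between
  \<open>m\<close> and \<open>m'\<close>.\<close>

lemma measure_between_pos:
  assumes z: "L2_set z {..<n} \<noteq> 0" and "m < f z / L2_set z {..<n}" "f z / L2_set z {..<n} < m'"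
  shows "measure (sphere_uniform n) {x \<in> rn n. m < f x \<and> f x < m'} > 0"
proof -
  let ?Lb = "rn_lebesgue n"
  define N where "N = L2_set z {..<n}"
  have N: "N > 0" using z by (simp add: N_def order_less_le)
  \<comment> \<open>Norm one half keeps the cube away from both the origin and the boundary of the
    ball.\<close>
  define w where "w = (\<lambda>i. (1 / (2 * N)) * z i)"
  have Lw: "L2_set w {..<n} = 1 / 2"
    unfolding w_def L2_set_scale using N by (simp add: N_def[symmetric])
  have fw: "f w = f z / N / 2" unfolding w_def homogeneous using N by simp
  define d where "d = min (min (f z / N - m) (m' - f z / N)) 1"
  have d: "0 < d" "d \<le> 1" "m + d \<le> f z / N" "f z / N + d \<le> m'"
    using assms(2,3) by (auto simp: d_def N_def[symmetric])
  define K where "K = L + \<bar>m\<bar> + \<bar>m'\<bar> + 1"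
  have K: "K \<ge> 1" using L_nonneg by (simp add: K_def)
  \<comment> \<open>On the cube, \<open>f\<close> and the two comparison values \<open>m * q\<close>
    and \<open>m' * q\<close> move by at most \<open>d / 4\<close> altogether, while at
    \<open>w\<close> the gap is at least \<open>d / 2\<close>. Since \<open>K \<ge> 1\<close> and
    \<open>d \<le> 1\<close>, the norm \<open>q\<close> moves by at most
    \<open>1 / 4\<close>.\<close>
  define e where "e = d / (4 * real n * K)"
  have e: "e > 0" using d K n by (simp add: e_def)
  have neK: "real n * e * K = d / 4" using K n by (simp add: e_def)
  define B where "B = (\<Pi>\<^sub>E i\<in>{..<n}. {w i - e..w i + e})"
  let ?E = "{x \<in> rn n. m < f x \<and> f x < m'}"
  let ?E' = "{x \<in> rn n. m < f (normalize_vec n x) \<and> f (normalize_vec n x) < m'}"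
  have sub: "B \<subseteq> rn_ball n \<inter> ?E'"
  proof
    fix y assume y: "y \<in> B"
    have yrn: "y \<in> rn n" using y by (auto simp: B_def rn_def PiE_def)
    have "(\<Sum>i<n. \<bar>y i - w i\<bar>) \<le> (\<Sum>i<n. e)"
    proof (intro sum_mono)
      fix i assume "i \<in> {..<n}"
      then have "y i \<in> {w i - e..w i + e}" using y unfolding B_def by (rule PiE_mem[rotated])
      then show "\<bar>y i - w i\<bar> \<le> e" by (simp add: abs_le_iff)
    qed
    then have s: "(\<Sum>i<n. \<bar>y i - w i\<bar>) \<le> real n * e" by simp
    define q where "q = L2_set y {..<n}"
    have q: "\<bar>q - 1 / 2\<bar> \<le> real n * e"
      using L2_set_diff_le[of "{..<n}" y w] s by (simp add: q_def Lw)
    have "real n * e * 1 \<le> real n * e * K" using K e by (intro mult_left_mono) auto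
    then have ne: "real n * e \<le> 1 / 4" using neK d by simp
    then have q': "1 / 4 \<le> q" "q \<le> 1" using q by (auto simp: abs_le_iff)
    have fy: "\<bar>f y - f w\<bar> \<le> L * (real n * e)"
      using lipschitz[of y w] mult_left_mono[OF s L_nonneg] by linarith
    have "\<bar>m * (q - 1 / 2)\<bar> \<le> \<bar>m\<bar> * (real n * e)"
      unfolding abs_mult by (intro mult_left_mono q) auto
    moreover have "\<bar>m' * (q - 1 / 2)\<bar> \<le> \<bar>m'\<bar> * (real n * e)"
      unfolding abs_mult by (intro mult_left_mono q) auto
    moreover have "L * (real n * e) + \<bar>m\<bar> * (real n * e) + \<bar>m'\<bar> * (real n * e) + real n * e = d / 4"
      unfolding neK[symmetric] by (simp add: K_def algebra_simps)
    moreover have "0 < real n * e" using n e by simp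
    moreover have "0 \<le> \<bar>m\<bar> * (real n * e)" "0 \<le> \<bar>m'\<bar> * (real n * e)" using e by auto
    moreover have "m * (q - 1 / 2) = m * q - m / 2" "m' * (q - 1 / 2) = m' * q - m' / 2"
      by (auto simp: algebra_simps)
    ultimately have "m * q < f y" "f y < m' * q"
      using fy fw d by (auto simp: abs_le_iff)
    then have "m < f y / q" "f y / q < m'" using q' by (auto simp: less_divide_eq divide_less_eq)
    then show "y \<in> rn_ball n \<inter> ?E'"
      using yrn q' by (simp add: rn_ball_def f_normalize_vec q_def)
  qed
  have E': "?E' \<in> sets ?Lb" by (rule sets_normalize_vec[OF sets_f(3)])
  have "ennreal ((2 * e) ^ n) = emeasure ?Lb B"
    unfolding B_def using e by (subst emeasure_rn_box) auto
  also have "\<dots> \<le> emeasure ?Lb (rn_ball n \<inter> ?E')"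
    using E' by (intro emeasure_mono sub) (auto intro: sets_rn_ball)
  finally have "emeasure ?Lb (rn_ball n \<inter> ?E') \<noteq> 0" using e by auto
  then have "emeasure (ball_uniform n) ?E' \<noteq> 0"
    using E' rn_ball_bounds(2)[OF n]
    by (simp add: ball_uniform_def sets_rn_ball ennreal_divide_eq_0_iff)
  then have "measure (ball_uniform n) ?E' > 0"
    using prob_space_ball_uniform[OF n, THEN prob_space.finite_measure]
    by (simp add: finite_measure.emeasure_eq_measure zero_less_measure_iff)
  then show ?thesis by (simp add: measure_sphere_uniform[OF sets_f(3)])
qed

text \<open>Between two medians \<open>a < b\<close> the value \<open>(a + b) / 2\<close> is
  attained at a unit vector, so the open gap has positive probability. Together with two disjoint
  events of probability at least one half this exceeds 1. This justifies the definite description in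
  \<open>median_sphere\<close>.\<close>

lemma is_median_unique:
  assumes "is_median (sphere_uniform n) f m" "is_median (sphere_uniform n) f m'"
  shows "m = m'"
proof -
  interpret prob_space "sphere_uniform n" by (rule prob_space_sphere_uniform[OF n])
  have False if med: "is_median (sphere_uniform n) f a" "is_median (sphere_uniform n) f b" and "a < b" for a b
  proof -
    have A: "prob {x \<in> rn n. f x \<le> a} \<ge> 1 / 2" and B: "prob {x \<in> rn n. b \<le> f x} \<ge> 1 / 2"
      using med by (simp_all add: is_median_def)
    obtain u where u: "u \<in> rn_sphere n" "f u \<le> a"
      by (rule sphere_uniform_witness[OF n sets_f(1) A])
    obtain v where v: "v \<in> rn_sphere n" "b \<le> f v"
      by (rule sphere_uniform_witness[OF n sets_f(2) B])
    obtain z where z: "L2_set z {..<n} \<noteq> 0" "f z / L2_set z {..<n} = (a + b) / 2"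
      using intermediate_value[OF u(1) v(1), of "(a + b) / 2"] u(2) v(2) \<open>a < b\<close> by auto
    have pos: "prob {x \<in> rn n. a < f x \<and> f x < b} > 0"
      using measure_between_pos[OF z(1), of a b] z(2) \<open>a < b\<close> by simp
    have "prob ({x \<in> rn n. f x \<le> a} \<union> {x \<in> rn n. b \<le> f x}) = prob {x \<in> rn n. f x \<le> a} + prob {x \<in> rn n. b \<le> f x}"
      using sets_f \<open>a < b\<close> by (intro finite_measure_Union) auto
    moreover have "prob ({x \<in> rn n. f x \<le> a} \<union> {x \<in> rn n. b \<le> f x} \<union> {x \<in> rn n. a < f x \<and> f x < b})
      = prob ({x \<in> rn n. f x \<le> a} \<union> {x \<in> rn n. b \<le> f x}) + prob {x \<in> rn n. a < f x \<and> f x < b}"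
      using sets_f by (intro finite_measure_Union) auto
    ultimately show False using A B pos
      prob_le_1[of "{x \<in> rn n. f x \<le> a} \<union> {x \<in> rn n. b \<le> f x} \<union> {x \<in> rn n. a < f x \<and> f x < b}"]
      by linarith
  qed
  then show ?thesis using assms by (metis linorder_neqE_linordered_idom)
qed

lemma is_median_median_sphere: "is_median (sphere_uniform n) f (median_sphere n f)"
proof -
  obtain m where m: "is_median (sphere_uniform n) f m"
    using is_median_exists[OF prob_space_sphere_uniform[OF n] measurable_f_sphere] by blast
  then show ?thesis unfolding median_sphere_def by (rule theI) (rule is_median_unique[OF _ m])
qed

text \<open>A value of \<open>f\<close> below the bound forces the l1 norm below
  \<open>sqrt n / 9\<close>, which has probability less than one half.\<close>

lemma median_sphere_ge_of_l1:
  assumes d: "d > 0" and "\<And>x. d * (\<Sum>i<n. \<bar>x i\<bar>) \<le> f x"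
  shows "d * sqrt (real n) / 9 \<le> median_sphere n f"
proof (rule is_median_ge[OF prob_space_sphere_uniform[OF n] measurable_f_sphere is_median_median_sphere])
  interpret prob_space "sphere_uniform n" by (rule prob_space_sphere_uniform[OF n])
  have "{x \<in> space (rn_lebesgue n). (\<Sum>i<n. \<bar>x i\<bar>) \<le> sqrt (real n) / 9} \<in> sets (rn_lebesgue n)"
    by measurable
  moreover have "{x \<in> rn n. f x \<le> d * sqrt (real n) / 9} \<subseteq> {x \<in> rn n. (\<Sum>i<n. \<bar>x i\<bar>) \<le> sqrt (real n) / 9}"
  proof safe
    fix x assume "f x \<le> d * sqrt (real n) / 9"
    then have "d * (\<Sum>i<n. \<bar>x i\<bar>) \<le> d * (sqrt (real n) / 9)" using assms(2)[of x] by simp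
    then show "(\<Sum>i<n. \<bar>x i\<bar>) \<le> sqrt (real n) / 9" using d by (rule mult_left_le_imp_le)
  qed
  ultimately have "prob {x \<in> rn n. f x \<le> d * sqrt (real n) / 9}
     \<le> prob {x \<in> rn n. (\<Sum>i<n. \<bar>x i\<bar>) \<le> sqrt (real n) / 9}"
    by (intro finite_measure_mono) auto
  then show "prob {x \<in> space (sphere_uniform n). f x \<le> d * sqrt (real n) / 9} < 1 / 2"
    using measure_sphere_l1_lt_half(1)[OF n] by simp
qed

lemma median_sphere_ge:
  assumes "\<And>u. u \<in> rn_sphere n \<Longrightarrow> b \<le> f u"
  shows "b \<le> median_sphere n f"
proof -
  have "measure (sphere_uniform n) {x \<in> rn n. f x \<le> median_sphere n f} \<ge> 1 / 2"
    using is_median_median_sphere by (simp add: is_median_def)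
  then obtain u where "u \<in> rn_sphere n" "f u \<le> median_sphere n f"
    by (rule sphere_uniform_witness[OF n sets_f(1)])
  then show ?thesis using assms[of u] by simp
qed

lemma median_sphere_le:
  assumes "\<And>x. (\<And>i. i < n \<Longrightarrow> \<bar>x i\<bar> \<le> 40 * sqrt ((1 + ln (real n)) / real n)) \<Longrightarrow> f x \<le> b"
  shows "median_sphere n f \<le> b"
proof (rule is_median_le[OF prob_space_sphere_uniform[OF n] measurable_f_sphere is_median_median_sphere])
  interpret prob_space "sphere_uniform n" by (rule prob_space_sphere_uniform[OF n])
  define t where "t = 40 * sqrt ((1 + ln (real n)) / real n)"
  have ln: "ln (real n) \<ge> 0" using n by simp
  then have t: "t \<ge> 0" by (simp add: t_def)
  note Q = sets_linf_rn[of n t]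
  have "prob {x \<in> rn n. b < f x} \<le> prob {x \<in> rn n. \<exists>i<n. t < \<bar>x i\<bar>}"
  proof (intro finite_measure_mono)
    show "{x \<in> rn n. b < f x} \<subseteq> {x \<in> rn n. \<exists>i<n. t < \<bar>x i\<bar>}"
    proof safe
      fix x assume "b < f x"
      then show "\<exists>i<n. t < \<bar>x i\<bar>" using assms[of x] unfolding t_def by force
    qed
  qed (unfold sets_sphere_uniform, rule Q)
  \<comment> \<open>The radius \<open>r = 1 / 15\<close> makes the first term at most
    \<open>1 / 5\<close>. With the factor 40 in \<open>t\<close> the exponent becomes
    \<open>32 / 9 * (1 + ln n)\<close>, which exceeds \<open>3 + ln n\<close>.\<close>
  also have "\<dots> \<le> (exp 1 * (1 / 15)) ^ n + 2 * real n * exp (- real n * (t * (1 / 15))\<^sup>2 / 2)"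
    by (rule measure_sphere_linf_le[OF n _ t]) simp
  also have "\<dots> \<le> 1 / 5 + 1 / 4"
  proof (rule add_mono)
    have "(exp 1 * (1 / 15 :: real)) ^ n \<le> (1 / 5) ^ n"
      using exp_le by (intro power_mono) auto
    also have "\<dots> \<le> (1 / 5) ^ 1" using n by (intro power_decreasing) auto
    finally show "(exp 1 * (1 / 15 :: real)) ^ n \<le> 1 / 5" by simp
    \<comment> \<open>From \<open>e \<ge> 2\<close> one gets
      \<open>exp (3 + ln n) \<ge> 8 * n\<close>, so the union bound over \<open>2 * n\<close> caps
      costs at most \<open>1 / 4\<close>.\<close>
    have e: "2 \<le> exp (1 :: real)" using exp_ge_add_one_self[of 1] by simp
    have "8 * real n \<le> exp 1 ^ 3 * real n"
      using power_mono[OF e, of 3] by (intro mult_right_mono) auto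
    also have "\<dots> = exp (3 + ln (real n))" using n by (simp add: exp_add exp_of_nat_mult[symmetric])
    also have "\<dots> \<le> exp (real n * (t * (1 / 15))\<^sup>2 / 2)"
    proof -
      have "(t * (1 / 15))\<^sup>2 = 64 / 9 * ((1 + ln (real n)) / real n)"
        using ln unfolding t_def by (simp add: power_mult_distrib power_divide)
      then have "real n * (t * (1 / 15))\<^sup>2 / 2 = 32 / 9 * (1 + ln (real n))"
        using n by simp
      then show ?thesis using ln by simp
    qed
    finally show "2 * real n * exp (- real n * (t * (1 / 15))\<^sup>2 / 2) \<le> 1 / 4"
      by (simp add: exp_minus field_simps)
  qed
  finally show "prob {x \<in> space (sphere_uniform n). b < f x} < 1 / 2" by simp
qed

end

section \<open>The top-\<open>k\<close> norm and its dual\<close>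

text \<open>The threshold \<open>\<theta>\<close> is \<open>\<bar>x\<bar>\<^bsub>[k]\<^esub>\<close>.\<close>

lemma topk_norm_threshold:
  assumes k: "1 \<le> k" "k \<le> n"
  obtains S \<theta> where "S \<subseteq> {..<n}" "card S = k" "topk_norm n k x = (\<Sum>i\<in>S. \<bar>x i\<bar>)" "0 \<le> \<theta>"
    "\<forall>i\<in>S. \<theta> \<le> \<bar>x i\<bar>" "\<forall>i\<in>{..<n} - S. \<bar>x i\<bar> \<le> \<theta>"
proof -
  let ?f = "\<lambda>i. \<bar>x i\<bar>"
  \<comment> \<open>\<open>p\<close> lists the coordinates by non-increasing absolute value. Its
    first \<open>k\<close> entries form \<open>S\<close>, and position \<open>k - 1\<close>, counted
    from 0, supplies the threshold.\<close>
  define p where "p = rev (sort_key ?f [0..<n])"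
  have p: "distinct p" "set p = {..<n}" "length p = n"
    by (auto simp: p_def)
  have "sort (map ?f [0..<n]) = map ?f (sort_key ?f [0..<n])"
    by (rule properties_for_sort) simp_all
  then have ad: "rev (sort (map ?f [0..<n])) = map ?f p"
    by (simp add: p_def rev_map)
  have srt: "sorted (rev (map ?f p))" by (simp add: p_def rev_map)
  have anti: "?f (p ! b) \<le> ?f (p ! a)" if "a \<le> b" "b < n" for a b
    using sorted_rev_nth_mono[OF srt, of a b] that p by simp
  define S where "S = (!) p ` {..<k}"
  have inj: "inj_on ((!) p) {..<k}"
    using p k by (intro inj_on_nth) auto
  have "topk_norm n k x = (\<Sum>i<k. ?f (p ! i))"
    unfolding topk_norm_def abs_desc_def ad One_nat_def sum.atLeast1_atMost_eq
    using p k by (intro sum.cong) auto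
  then have 1: "topk_norm n k x = (\<Sum>i\<in>S. ?f i)"
    by (simp add: S_def sum.reindex[OF inj])
  have 2: "S \<subseteq> {..<n}" using p k nth_mem[of _ p] by (force simp: S_def)
  have 3: "card S = k" by (simp add: S_def card_image[OF inj])
  have 4: "?f (p ! (k - 1)) \<le> ?f i" if "i \<in> S" for i
    using that k anti by (auto simp: S_def)
  have 5: "?f i \<le> ?f (p ! (k - 1))" if i: "i < n" "i \<notin> S" for i
  proof -
    obtain b where b: "b < n" "i = p ! b"
      using i p by (metis in_set_conv_nth lessThan_iff)
    then have "\<not> b < k" using i by (auto simp: S_def)
    then show ?thesis using anti[of "k - 1" b] b by simp
  qed
  show ?thesis by (rule that[OF 2 3 1 abs_ge_zero]) (use 4 5 in auto)
qed

corollary topk_norm_witness: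
  assumes k: "1 \<le> k" "k \<le> n"
  obtains S where "S \<subseteq> {..<n}" "card S = k" "topk_norm n k x = (\<Sum>i\<in>S. \<bar>x i\<bar>)"
  by (rule topk_norm_threshold[OF k, of x]) (rule that)

text \<open>This inequality also says that the dual norm of \<open>\<Phi>\<^bsub>(k)\<^esub>\<close> is at most \<open>max l\<^sub>\<infinity> (l\<^sub>1 / k)\<close>.\<close>

lemma sum_mult_le_topk_norm:
  assumes k: "1 \<le> k" "k \<le> n"
    and z: "\<And>i. i < n \<Longrightarrow> 0 \<le> z i" "\<And>i. i < n \<Longrightarrow> z i \<le> D" and s: "(\<Sum>i<n. z i) \<le> real k * D"
  shows "(\<Sum>i<n. \<bar>x i\<bar> * z i) \<le> D * topk_norm n k x"
proof -
  obtain S \<theta> where S: "S \<subseteq> {..<n}" "card S = k" "topk_norm n k x = (\<Sum>i\<in>S. \<bar>x i\<bar>)" "0 \<le> \<theta>"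
    "\<forall>i\<in>S. \<theta> \<le> \<bar>x i\<bar>" "\<forall>i\<in>{..<n} - S. \<bar>x i\<bar> \<le> \<theta>"
    by (rule topk_norm_threshold[OF k, of x])
  \<comment> \<open>Split \<open>\<bar>x i\<bar>\<close> into \<open>\<theta>\<close> and the excess
    over it. The excess is nonnegative on \<open>S\<close>, where \<open>z i \<le> D\<close> is
    used, and nonpositive elsewhere; the bound on the total weight controls the
    \<open>\<theta>\<close> part.\<close>
  have "(\<Sum>i<n. \<bar>x i\<bar> * z i) \<le> (\<Sum>i<n. \<theta> * z i + (if i \<in> S then (\<bar>x i\<bar> - \<theta>) * D else 0))"
  proof (intro sum_mono)
    fix i assume i: "i \<in> {..<n}"
    show "\<bar>x i\<bar> * z i \<le> \<theta> * z i + (if i \<in> S then (\<bar>x i\<bar> - \<theta>) * D else 0)"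
    proof (cases "i \<in> S")
      case True
      have "(\<bar>x i\<bar> - \<theta>) * z i \<le> (\<bar>x i\<bar> - \<theta>) * D"
        using True S(5) z(2) i by (intro mult_left_mono) auto
      then show ?thesis using True by (simp add: algebra_simps)
    next
      case False
      then show ?thesis using S(6) z(1) i by (auto intro!: mult_right_mono)
    qed
  qed
  also have "\<dots> = \<theta> * (\<Sum>i<n. z i) + (\<Sum>i\<in>S. (\<bar>x i\<bar> - \<theta>) * D)"
    using S(1) by (simp add: sum.distrib sum_distrib_left[symmetric] sum.If_cases Int_absorb1 inf.absorb2)
  also have "\<dots> \<le> \<theta> * (real k * D) + (\<Sum>i\<in>S. (\<bar>x i\<bar> - \<theta>) * D)"
    using s S(4) by (intro add_right_mono mult_left_mono)
  also have "(\<Sum>i\<in>S. (\<bar>x i\<bar> - \<theta>) * D) = (topk_norm n k x - real k * \<theta>) * D"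
    using S(2,3) by (simp add: sum_distrib_right[symmetric] sum_subtractf)
  finally show ?thesis by (simp add: algebra_simps)
qed

section \<open>Comparison of the top-k norm with other norms, and its restrictions\<close>

lemma sum_subset_le_topk_norm:
  assumes k: "1 \<le> k" "k \<le> n" and S: "S \<subseteq> {..<n}" "card S \<le> k"
  shows "(\<Sum>i\<in>S. \<bar>x i\<bar>) \<le> topk_norm n k x"
proof -
  have "(\<Sum>i<n. \<bar>x i\<bar> * (if i \<in> S then 1 else 0)) \<le> 1 * topk_norm n k x"
    using S by (intro sum_mult_le_topk_norm k) (auto simp: sum.If_cases inf.absorb2)
  moreover have "(\<Sum>i<n. \<bar>x i\<bar> * (if i \<in> S then 1 else 0)) = (\<Sum>i\<in>S. \<bar>x i\<bar>)"
    using S(1) by (simp add: if_distrib[where f = "(*) _"] sum.If_cases inf.absorb2 cong: if_cong)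
  ultimately show ?thesis by simp
qed

text \<open>The constant weights \<open>k / n\<close> are bounded by 1 and have total
  \<open>k\<close>.\<close>

lemma topk_norm_ge_l1:
  assumes k: "1 \<le> k" "k \<le> n"
  shows "real k / real n * (\<Sum>i<n. \<bar>x i\<bar>) \<le> topk_norm n k x"
proof -
  have "(\<Sum>i<n. \<bar>x i\<bar> * (real k / real n)) \<le> 1 * topk_norm n k x"
    using k by (intro sum_mult_le_topk_norm k) auto
  then show ?thesis by (simp add: sum_distrib_left mult.commute)
qed

lemma topk_norm_le:
  assumes k: "1 \<le> k" "k \<le> n" and t: "\<And>i. i < n \<Longrightarrow> \<bar>x i\<bar> \<le> t"
  shows "topk_norm n k x \<le> real k * t"
proof -
  obtain S where S: "S \<subseteq> {..<n}" "card S = k" "topk_norm n k x = (\<Sum>i\<in>S. \<bar>x i\<bar>)"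
    by (rule topk_norm_witness[OF k])
  then show ?thesis using t sum_bounded_above[of S "\<lambda>i. \<bar>x i\<bar>" t] by auto
qed

lemma topk_norm_le_l1:
  assumes k: "1 \<le> k" "k \<le> n"
  shows "topk_norm n k x \<le> (\<Sum>i<n. \<bar>x i\<bar>)"
proof -
  obtain S where S: "S \<subseteq> {..<n}" "card S = k" "topk_norm n k x = (\<Sum>i\<in>S. \<bar>x i\<bar>)"
    by (rule topk_norm_witness[OF k])
  then show ?thesis by (simp add: sum_mono2)
qed

lemma topk_norm_le_L2:
  assumes k: "1 \<le> k" "k \<le> n"
  shows "topk_norm n k x \<le> sqrt (real k) * L2_set x {..<n}"
proof -
  obtain S where S: "S \<subseteq> {..<n}" "card S = k" "topk_norm n k x = (\<Sum>i\<in>S. \<bar>x i\<bar>)"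
    by (rule topk_norm_witness[OF k])
  have "topk_norm n k x \<le> sqrt (real k) * L2_set x S"
    using S l1_le_L2[of S x] finite_subset[OF S(1)] by simp
  also have "\<dots> \<le> sqrt (real k) * L2_set x {..<n}"
    unfolding L2_set_def using S(1) by (intro mult_left_mono real_sqrt_le_mono sum_mono2) auto
  finally show ?thesis .
qed

text \<open>Allowing all cardinalities up to \<open>k\<close> makes the family stable under
  intersection with \<open>{..<j}\<close>, as restriction to fewer coordinates requires.\<close>

lemma topk_norm_eq_Max:
  assumes k: "1 \<le> k" "k \<le> n"
  shows "topk_norm n k x = Max ((\<lambda>S. \<Sum>i\<in>S. \<bar>x i\<bar>) ` {S. S \<subseteq> {..<n} \<and> card S \<le> k})"
proof (rule Max_eqI[symmetric])
  show "finite ((\<lambda>S. \<Sum>i\<in>S. \<bar>x i\<bar>) ` {S. S \<subseteq> {..<n} \<and> card S \<le> k})" by simp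
  show "y \<le> topk_norm n k x" if "y \<in> (\<lambda>S. \<Sum>i\<in>S. \<bar>x i\<bar>) ` {S. S \<subseteq> {..<n} \<and> card S \<le> k}" for y
    using that sum_subset_le_topk_norm[OF k] by auto
  obtain S where "S \<subseteq> {..<n}" "card S = k" "topk_norm n k x = (\<Sum>i\<in>S. \<bar>x i\<bar>)"
    by (rule topk_norm_witness[OF k])
  then show "topk_norm n k x \<in> (\<lambda>S. \<Sum>i\<in>S. \<bar>x i\<bar>) ` {S. S \<subseteq> {..<n} \<and> card S \<le> k}"
    by auto
qed

text \<open>Padded coordinates contribute nothing, so intersecting a subset with
  \<open>{..<j}\<close> preserves its sum. If \<open>j < k\<close>, the cardinality limit becomes
  \<open>j\<close> and the norm is l1.\<close>

lemma restrict_topk_norm: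
  assumes k: "1 \<le> k" "k \<le> n" and j: "1 \<le> j" "j \<le> n"
  shows "restrict_norm n (topk_norm n k) j = topk_norm j (min k j)"
proof
  fix x
  let ?g = "\<lambda>z S. \<Sum>i\<in>S. \<bar>z i\<bar> :: real"
  let ?z = "pad_zeros n j x"
  have eq: "?g ?z S = ?g x (S \<inter> {..<j})" if "S \<subseteq> {..<n}" for S
  proof -
    have "?g ?z S = ?g ?z (S \<inter> {..<j})"
      using that finite_subset[OF that] by (intro sum.mono_neutral_right) (auto simp: pad_zeros_def)
    also have "\<dots> = ?g x (S \<inter> {..<j})"
      using that by (intro sum.cong) (auto simp: pad_zeros_def)
    finally show ?thesis .
  qed
  have "?g ?z ` {S. S \<subseteq> {..<n} \<and> card S \<le> k} = ?g x ` {S. S \<subseteq> {..<j} \<and> card S \<le> min k j}"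
  proof (intro equalityI subsetI)
    fix y assume "y \<in> ?g ?z ` {S. S \<subseteq> {..<n} \<and> card S \<le> k}"
    then obtain S where S: "S \<subseteq> {..<n}" "card S \<le> k" "y = ?g ?z S" by auto
    have "card (S \<inter> {..<j}) \<le> card S" using finite_subset[OF S(1)] by (intro card_mono) auto
    moreover have "card (S \<inter> {..<j}) \<le> card {..<j}" by (intro card_mono) auto
    ultimately show "y \<in> ?g x ` {S. S \<subseteq> {..<j} \<and> card S \<le> min k j}"
      using S eq[OF S(1)] by (intro image_eqI[where x = "S \<inter> {..<j}"]) auto
  next
    fix y assume "y \<in> ?g x ` {S. S \<subseteq> {..<j} \<and> card S \<le> min k j}"
    then obtain S where S: "S \<subseteq> {..<j}" "card S \<le> min k j" "y = ?g x S" by auto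
    then have "S \<subseteq> {..<n}" using j by auto
    then show "y \<in> ?g ?z ` {S. S \<subseteq> {..<n} \<and> card S \<le> k}"
      using S eq[of S] by (intro image_eqI[where x = S]) (auto simp: inf.absorb1)
  qed
  then show "restrict_norm n (topk_norm n k) j x = topk_norm j (min k j) x"
    using k j by (simp add: restrict_norm_def topk_norm_eq_Max)
qed

text \<open>Each weighted partial l1 sum changes by at most the l1 distance because its weight is at
  most 1, and a finite maximum inherits this. Scaling by \<open>\<bar>c\<bar>\<close> is monotone,
  hence commutes with the maximum.\<close>

lemma lipschitz_homogeneous_Max:
  assumes n: "n > 0" and F: "finite F" "F \<noteq> {}"
    and w: "\<And>w S. (w, S) \<in> F \<Longrightarrow> 0 \<le> w \<and> w \<le> 1 \<and> S \<subseteq> {..<n}"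
    and f: "\<And>x. f x = Max ((\<lambda>(w, S). w * (\<Sum>i\<in>S. \<bar>x i\<bar>)) ` F)"
  shows "lipschitz_homogeneous n f 1"
proof
  let ?g = "\<lambda>x (w, S). w * (\<Sum>i\<in>S. \<bar>x i\<bar>) :: real"
  show "n > 0" by fact
  have "(\<lambda>x. Max ((\<lambda>p. ?g x p) ` F)) \<in> borel_measurable (rn_lebesgue n)"
  proof (rule borel_measurable_Max[OF F(1)])
    fix p assume "p \<in> F"
    then show "(\<lambda>x. ?g x p) \<in> borel_measurable (rn_lebesgue n)"
      using w by (cases p) (auto intro!: borel_measurable_times measurable_l1_rn)
  qed
  then show "f \<in> borel_measurable (rn_lebesgue n)"
    using f by (simp add: fun_eq_iff cong: measurable_cong)
  fix c :: real and x y :: "nat \<Rightarrow> real"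
  have "?g (\<lambda>i. c * x i) ` F = (*) \<bar>c\<bar> ` ?g x ` F"
    unfolding image_image
    by (intro image_cong refl) (auto simp: abs_mult sum_distrib_left mult_ac)
  moreover have "Max ((*) \<bar>c\<bar> ` ?g x ` F) = \<bar>c\<bar> * Max (?g x ` F)"
    using F by (intro mono_Max_commute[symmetric] monoI mult_left_mono) auto
  ultimately show "f (\<lambda>i. c * x i) = \<bar>c\<bar> * f x" by (simp add: f)
  have *: "f x \<le> f y + (\<Sum>i<n. \<bar>x i - y i\<bar>)" for x y
  proof -
    have "?g x p \<le> f y + (\<Sum>i<n. \<bar>x i - y i\<bar>)" if p: "p \<in> F" for p
    proof -
      obtain w' S where wS: "p = (w', S)" by (cases p)
      note w' = w[OF p[unfolded wS]]
      have "(\<Sum>i\<in>S. \<bar>x i\<bar>) \<le> (\<Sum>i\<in>S. \<bar>y i\<bar> + \<bar>x i - y i\<bar>)" by (intro sum_mono) auto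
      also have "\<dots> \<le> (\<Sum>i\<in>S. \<bar>y i\<bar>) + (\<Sum>i<n. \<bar>x i - y i\<bar>)"
        using w' by (simp add: sum.distrib sum_mono2)
      finally have "?g x p \<le> w' * ((\<Sum>i\<in>S. \<bar>y i\<bar>) + (\<Sum>i<n. \<bar>x i - y i\<bar>))"
        using w' by (simp add: wS mult_left_mono)
      also have "\<dots> \<le> ?g y p + 1 * (\<Sum>i<n. \<bar>x i - y i\<bar>)"
        unfolding distrib_left using w' by (simp add: wS mult_right_mono sum_nonneg mult_left_le_one_le)
      also have "?g y p \<le> f y" unfolding f using F p by (intro Max_ge) auto
      finally show ?thesis by simp
    qed
    then show ?thesis unfolding f[of x] using F by (intro Max.boundedI) auto
  qed
  show "\<bar>f x - f y\<bar> \<le> 1 * (\<Sum>i<n. \<bar>x i - y i\<bar>)"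
    using *[of x y] *[of y x] by (simp add: abs_minus_commute abs_le_iff)
qed

lemma lipschitz_homogeneous_topk_norm:
  assumes k: "1 \<le> k" "k \<le> n"
  shows "lipschitz_homogeneous n (topk_norm n k) 1"
proof (rule lipschitz_homogeneous_Max[where F = "Pair 1 ` {S. S \<subseteq> {..<n} \<and> card S \<le> k}"])
  show "topk_norm n k x = Max ((\<lambda>(w, S). w * (\<Sum>i\<in>S. \<bar>x i\<bar>)) ` Pair 1 ` {S. S \<subseteq> {..<n} \<and> card S \<le> k})" for x
    by (simp add: topk_norm_eq_Max[OF k] image_image)
qed (use k in auto)

section \<open>The dual norm and its restrictions as an explicit maximum\<close>

definition linf_l1_family :: "nat \<Rightarrow> nat \<Rightarrow> (real \<times> nat set) set" where
  "linf_l1_family k j = insert (1 / real k, {..<j}) ((\<lambda>i. (1, {i})) ` {..<j})"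

text \<open>For \<open>k \<ge> 1\<close> and \<open>j \<ge> 1\<close> this is the maximum of
  l_infinity and l1 / k on the first \<open>j\<close> coordinates; the family form fits
  \<open>lipschitz_homogeneous_Max\<close>.\<close>

definition linf_l1 :: "nat \<Rightarrow> nat \<Rightarrow> (nat \<Rightarrow> real) \<Rightarrow> real" where
  "linf_l1 k j x = Max ((\<lambda>(w, S). w * (\<Sum>i\<in>S. \<bar>x i\<bar>)) ` linf_l1_family k j)"

lemma linf_l1_ge:
  shows "(\<Sum>i<j. \<bar>x i\<bar>) / real k \<le> linf_l1 k j x" and "i < j \<Longrightarrow> \<bar>x i\<bar> \<le> linf_l1 k j x"
proof -
  have "w * (\<Sum>i\<in>S. \<bar>x i\<bar>) \<le> linf_l1 k j x" if "(w, S) \<in> linf_l1_family k j" for w S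
    unfolding linf_l1_def using that
    by (intro Max_ge image_eqI[where x = "(w, S)"]) (auto simp: linf_l1_family_def)
  from this[of "1 / real k" "{..<j}"] this[of 1 "{i}"]
  show "(\<Sum>i<j. \<bar>x i\<bar>) / real k \<le> linf_l1 k j x" "i < j \<Longrightarrow> \<bar>x i\<bar> \<le> linf_l1 k j x"
    by (auto simp: linf_l1_family_def)
qed

lemma linf_l1_le:
  assumes "(\<Sum>i<j. \<bar>x i\<bar>) / real k \<le> b" "\<And>i. i < j \<Longrightarrow> \<bar>x i\<bar> \<le> b"
  shows "linf_l1 k j x \<le> b"
  unfolding linf_l1_def linf_l1_family_def using assms by (intro Max.boundedI) auto

lemma lipschitz_homogeneous_linf_l1:
  assumes "1 \<le> k" "1 \<le> j"
  shows "lipschitz_homogeneous j (linf_l1 k j) 1"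
proof (rule lipschitz_homogeneous_Max[where F = "linf_l1_family k j"])
  show "linf_l1 k j x = Max ((\<lambda>(w, S). w * (\<Sum>i\<in>S. \<bar>x i\<bar>)) ` linf_l1_family k j)" for x
    by (simp add: linf_l1_def)
qed (use assms in \<open>auto simp: linf_l1_family_def\<close>)

text \<open>The upper bound is the weighted inequality with weights \<open>\<bar>?z i\<bar>\<close>
  and \<open>D = ?D\<close>. For the lower bound, a scaled sign vector recovers l1 / k and a signed
  basis vector recovers each coordinate. The parameter \<open>k\<close> stays the same for every
  \<open>j\<close>.\<close>

lemma restrict_dual_topk_norm:
  assumes k: "1 \<le> k" "k \<le> n" and j: "1 \<le> j" "j \<le> n"
  shows "restrict_norm n (dual_norm n (topk_norm n k)) j = linf_l1 k j"
proof
  fix y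
  let ?A = "{x \<in> rn n. topk_norm n k x \<le> 1}"
  let ?z = "pad_zeros n j y" and ?D = "linf_l1 k j y"
  have D0: "0 \<le> ?D" using linf_l1_ge(2)[of 0 j y k] j by linarith
  have pair: "(\<Sum>i<n. x i * ?z i) = (\<Sum>i<j. x i * y i)" for x
  proof -
    have "(\<Sum>i<n. x i * ?z i) = (\<Sum>i<j. x i * ?z i)"
      using j by (intro sum.mono_neutral_right) (auto simp: pad_zeros_def)
    also have "\<dots> = (\<Sum>i<j. x i * y i)"
      using j by (intro sum.cong) (auto simp: pad_zeros_def)
    finally show ?thesis .
  qed
  have upper: "(\<Sum>i<n. x i * ?z i) \<le> ?D" if x: "x \<in> ?A" for x
  proof -
    \<comment> \<open>Writing the l1 norm as a pairing with the sign vector lets \<open>pair\<close>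
      discard the padding.\<close>
    have "(\<Sum>i<n. \<bar>?z i\<bar>) = (\<Sum>i<n. sgn (?z i) * ?z i)" by (intro sum.cong) (auto simp: abs_sgn mult.commute)
    also have "\<dots> = (\<Sum>i<j. sgn (?z i) * y i)" by (rule pair)
    also have "\<dots> = (\<Sum>i<j. \<bar>y i\<bar>)"
      using j by (intro sum.cong) (auto simp: pad_zeros_def abs_sgn mult.commute)
    finally have "(\<Sum>i<n. \<bar>?z i\<bar>) \<le> real k * ?D"
      using linf_l1_ge(1)[of y j k] k by (simp add: divide_le_eq mult.commute)
    then have "(\<Sum>i<n. \<bar>x i\<bar> * \<bar>?z i\<bar>) \<le> ?D * topk_norm n k x"
      using linf_l1_ge(2)[of _ j y k] D0
      by (intro sum_mult_le_topk_norm k) (auto simp: pad_zeros_def)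
    also have "\<dots> \<le> ?D * 1" using x D0 by (intro mult_left_mono) auto
    finally have "(\<Sum>i<n. \<bar>x i\<bar> * \<bar>?z i\<bar>) \<le> ?D" by simp
    moreover have "(\<Sum>i<n. x i * ?z i) \<le> (\<Sum>i<n. \<bar>x i\<bar> * \<bar>?z i\<bar>)"
      unfolding abs_mult[symmetric] by (intro sum_mono) auto
    ultimately show ?thesis by linarith
  qed
  have bdd: "bdd_above ((\<lambda>x. \<Sum>i<n. x i * ?z i) ` ?A)"
    using upper by (intro bdd_aboveI2) blast
  have lower: "(\<Sum>i<j. x i * y i) \<le> dual_norm n (topk_norm n k) ?z" if "x \<in> ?A" for x
    unfolding dual_norm_def pair[symmetric] by (rule cSUP_upper[OF that bdd])
  have zero: "(\<lambda>i\<in>{..<n}. 0) \<in> ?A"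
    using topk_norm_le[OF k, of "\<lambda>i\<in>{..<n}. 0" 0] by (simp add: rn_def)
  show "restrict_norm n (dual_norm n (topk_norm n k)) j y = ?D"
  proof (rule antisym)
    show "restrict_norm n (dual_norm n (topk_norm n k)) j y \<le> ?D"
      unfolding restrict_norm_def dual_norm_def using zero upper by (intro cSUP_least) auto
    show "?D \<le> restrict_norm n (dual_norm n (topk_norm n k)) j y"
    proof (rule linf_l1_le)
      \<comment> \<open>All entries are at most \<open>1 / k\<close> in absolute value, so the top-k
        norm is at most 1. Entries from \<open>j\<close> on meet zeros of the padded vector.\<close>
      let ?x = "\<lambda>i\<in>{..<n}. sgn (y i) / real k"
      have "topk_norm n k ?x \<le> real k * (1 / real k)"
        using k by (intro topk_norm_le) (auto simp: abs_divide abs_sgn_eq divide_right_mono)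
      then have "?x \<in> ?A" using k by (simp add: rn_def)
      from lower[OF this] have "(\<Sum>i<j. ?x i * y i) \<le> dual_norm n (topk_norm n k) ?z" .
      also have "(\<Sum>i<j. ?x i * y i) = (\<Sum>i<j. \<bar>y i\<bar> / real k)"
        using j by (intro sum.cong) (auto simp: abs_sgn mult.commute)
      finally show "(\<Sum>i<j. \<bar>y i\<bar>) / real k \<le> restrict_norm n (dual_norm n (topk_norm n k)) j y"
        by (simp add: restrict_norm_def sum_divide_distrib)
    next
      fix i assume i: "i < j"
      let ?x = "\<lambda>m\<in>{..<n}. if m = i then sgn (y i) else 0"
      have "topk_norm n k ?x \<le> (\<Sum>m<n. \<bar>?x m\<bar>)" by (rule topk_norm_le_l1[OF k])
      also have "\<dots> = (\<Sum>m<n. if m = i then \<bar>sgn (y i)\<bar> else 0)" by (intro sum.cong) auto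
      also have "\<dots> \<le> 1" using i j by (simp add: abs_sgn_eq)
      finally have "?x \<in> ?A" by (simp add: rn_def)
      from lower[OF this] have "(\<Sum>m<j. ?x m * y m) \<le> dual_norm n (topk_norm n k) ?z" .
      also have "(\<Sum>m<j. ?x m * y m) = (\<Sum>m<j. if m = i then \<bar>y i\<bar> else 0)"
        using j by (intro sum.cong) (auto simp: abs_sgn mult.commute)
      finally show "\<bar>y i\<bar> \<le> restrict_norm n (dual_norm n (topk_norm n k)) j y"
        using i by (simp add: restrict_norm_def)
    qed
  qed
qed

section \<open>Maxima on the sphere and estimates of \<open>mc\<close>\<close>

lemma max_sphere_le:
  assumes "n > 0" "\<And>u. u \<in> rn_sphere n \<Longrightarrow> f u \<le> b"
  shows "max_sphere n f \<le> b"
proof -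
  have "L2_set (\<lambda>i. if i = 0 then 1 else 0 :: real) {..<n} \<noteq> 0"
    using assms(1) by (auto simp: L2_set_eq_0_rn)
  then have "rn_sphere n \<noteq> {}" using normalize_vec_in_sphere by blast
  then show ?thesis unfolding max_sphere_def by (rule cSUP_least) (rule assms(2))
qed

text \<open>The uniform bound \<open>b\<close> ensures that the real supremum is a genuine upper
  bound.\<close>

lemma max_sphere_ge:
  assumes "v \<in> rn_sphere n" "\<And>u. u \<in> rn_sphere n \<Longrightarrow> f u \<le> b"
  shows "f v \<le> max_sphere n f"
  unfolding max_sphere_def by (intro cSUP_upper assms(1) bdd_aboveI2[of _ f b] assms(2))

lemma topk_norm_le_on_sphere:
  assumes "1 \<le> k" "k \<le> n" "u \<in> rn_sphere n"
  shows "topk_norm n k u \<le> sqrt (real k)"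
  using topk_norm_le_L2[OF assms(1,2), of u] assms(3) by (simp add: rn_sphere_def)

lemma mc_topk_norm_le:
  assumes k: "1 \<le> k" "k \<le> n"
  shows "mc n (topk_norm n k) \<le> 9 * sqrt (real n / real k)"
proof -
  interpret lipschitz_homogeneous n "topk_norm n k" 1
    by (rule lipschitz_homogeneous_topk_norm[OF k])
  have m: "real k / real n * sqrt (real n) / 9 \<le> median_sphere n (topk_norm n k)"
    using k by (intro median_sphere_ge_of_l1 topk_norm_ge_l1) auto
  have b: "max_sphere n (topk_norm n k) \<le> sqrt (real k)"
    by (rule max_sphere_le[OF n]) (rule topk_norm_le_on_sphere[OF k])
  have "mc n (topk_norm n k) \<le> sqrt (real k) / (real k / real n * sqrt (real n) / 9)"
    unfolding mc_def
  proof (rule frac_le[OF _ b _ m])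
    show "0 < real k / real n * sqrt (real n) / 9" using k n by simp
  qed simp
  also have "\<dots> = 9 * (sqrt (real k) / real k) * (real n / sqrt (real n))" by simp
  also have "\<dots> = 9 * sqrt (real n / real k)"
    by (simp add: real_div_sqrt real_sqrt_divide sqrt_divide_self_eq divide_simps)
  finally show ?thesis .
qed

lemma mc_topk_norm_ge:
  assumes k: "1 \<le> k" "k \<le> n"
  shows "sqrt (real n / (real k * (1 + ln (real n)))) / 40 \<le> mc n (topk_norm n k)"
proof -
  interpret lipschitz_homogeneous n "topk_norm n k" 1
    by (rule lipschitz_homogeneous_topk_norm[OF k])
  let ?t = "40 * sqrt ((1 + ln (real n)) / real n)"
  \<comment> \<open>A positive median makes the quotient \<open>mc\<close> monotone in the estimates
    for numerator and denominator.\<close>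
  have "0 < real k / real n * sqrt (real n) / 9" using k n by simp
  also have "\<dots> \<le> median_sphere n (topk_norm n k)"
    using k by (intro median_sphere_ge_of_l1 topk_norm_ge_l1) auto
  finally have m0: "0 < median_sphere n (topk_norm n k)" .
  have m: "median_sphere n (topk_norm n k) \<le> real k * ?t"
    by (rule median_sphere_le, rule topk_norm_le[OF k])
  \<comment> \<open>Cauchy-Schwarz is sharp for a flat unit vector supported on \<open>k\<close>
    coordinates, so the maximum \<open>sqrt k\<close> is reached.\<close>
  define v where "v = (\<lambda>i\<in>{..<n}. if i < k then 1 / sqrt (real k) else 0)"
  have "(\<Sum>i<n. (v i)\<^sup>2) = (\<Sum>i<n. if i < k then 1 / real k else 0)"
    by (intro sum.cong) (auto simp: v_def power_divide)
  also have "\<dots> = (\<Sum>i<k. 1 / real k)"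
    using k by (intro sum.mono_neutral_cong_right) auto
  also have "\<dots> = 1" using k by simp
  finally have v: "v \<in> rn_sphere n"
    by (simp add: rn_sphere_def rn_def L2_set_def v_def)
  have "sqrt (real k) = (\<Sum>i<k. 1 / sqrt (real k))" by (simp add: real_div_sqrt)
  also have "\<dots> = (\<Sum>i<k. \<bar>v i\<bar>)" using k by (intro sum.cong) (auto simp: v_def)
  also have "\<dots> \<le> topk_norm n k v" using k by (intro sum_subset_le_topk_norm) auto
  also have "\<dots> \<le> max_sphere n (topk_norm n k)"
    by (rule max_sphere_ge[OF v topk_norm_le_on_sphere[OF k]])
  finally have b: "sqrt (real k) \<le> max_sphere n (topk_norm n k)" .
  have "sqrt (real n / (real k * (1 + ln (real n)))) / 40
      = sqrt (real k) / (real k * ?t)"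
    by (simp add: real_sqrt_divide real_sqrt_mult sqrt_divide_self_eq divide_simps)
  also have "\<dots> \<le> mc n (topk_norm n k)"
    unfolding mc_def by (intro frac_le b m0 m order_trans[OF _ b]) auto
  finally show ?thesis .
qed

lemma linf_l1_le_on_sphere:
  assumes k: "1 \<le> k" and u: "u \<in> rn_sphere j"
  shows "linf_l1 k j u \<le> max 1 (sqrt (real j) / real k)"
proof (rule linf_l1_le)
  have 1: "L2_set u {..<j} = 1" using u by (simp add: rn_sphere_def)
  have "(\<Sum>i<j. \<bar>u i\<bar>) / real k \<le> sqrt (real j) / real k"
    using l1_le_L2[of "{..<j}" u] by (simp add: 1 divide_right_mono)
  then show "(\<Sum>i<j. \<bar>u i\<bar>) / real k \<le> max 1 (sqrt (real j) / real k)" by simp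
  have "u \<in> rn_ball j" using u by (simp add: rn_sphere_def rn_ball_def)
  then show "\<bar>u i\<bar> \<le> max 1 (sqrt (real j) / real k)" if "i < j" for i
    using abs_le_1_rn_ball[of u j i] that by (simp add: max.coboundedI1)
qed

text \<open>The squares of \<open>j\<close> coordinates sum to 1, so the largest coordinate is at
  least \<open>1 / sqrt j\<close> in absolute value.\<close>

lemma linf_l1_ge_on_sphere:
  assumes j: "1 \<le> j" and u: "u \<in> rn_sphere j"
  shows "1 / sqrt (real j) \<le> linf_l1 k j u"
proof -
  let ?M = "linf_l1 k j u"
  have M0: "0 \<le> ?M" using linf_l1_ge(2)[of 0 j u k] j by linarith
  have "1 = (\<Sum>i<j. (u i)\<^sup>2)" using u by (simp add: rn_sphere_def L2_set_def)
  also have "\<dots> \<le> (\<Sum>i<j. ?M\<^sup>2)"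
    using linf_l1_ge(2)[of _ j u k] by (intro sum_mono) (simp add: abs_le_square_iff[symmetric] M0)
  also have "\<dots> = real j * ?M\<^sup>2" by simp
  finally have "sqrt 1 \<le> sqrt (real j * ?M\<^sup>2)" by (rule real_sqrt_le_mono)
  then have "1 \<le> sqrt (real j) * ?M" using M0 by (simp add: real_sqrt_mult)
  then show ?thesis using j by (simp add: divide_le_eq mult.commute)
qed

lemma median_linf_l1_ge:
  assumes k: "1 \<le> k" and j: "1 \<le> j"
  shows "sqrt (real j) / (9 * real k) \<le> median_sphere j (linf_l1 k j)"
    and "1 / sqrt (real j) \<le> median_sphere j (linf_l1 k j)"
proof -
  interpret lipschitz_homogeneous j "linf_l1 k j" 1
    by (rule lipschitz_homogeneous_linf_l1[OF assms])
  have "1 / real k * sqrt (real j) / 9 \<le> median_sphere j (linf_l1 k j)"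
    using k linf_l1_ge(1)[of _ j k] by (intro median_sphere_ge_of_l1) auto
  then show "sqrt (real j) / (9 * real k) \<le> median_sphere j (linf_l1 k j)" by (simp add: mult.commute)
  show "1 / sqrt (real j) \<le> median_sphere j (linf_l1 k j)"
    by (rule median_sphere_ge) (rule linf_l1_ge_on_sphere[OF j])
qed

text \<open>Multiplying the two lower bounds for the median cancels \<open>j\<close> and gives
  \<open>m^2 \<ge> 1 / (9 * k)\<close>, which controls the alternative 1 in the maximum. The
  alternative \<open>sqrt j / k\<close> is controlled by the first bound alone.\<close>

lemma mc_linf_l1_le:
  assumes k: "1 \<le> k" and j: "1 \<le> j"
  shows "mc j (linf_l1 k j) \<le> 9 * sqrt (real k)"
proof -
  interpret lipschitz_homogeneous j "linf_l1 k j" 1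
    by (rule lipschitz_homogeneous_linf_l1[OF assms])
  define m where "m = median_sphere j (linf_l1 k j)"
  note m = median_linf_l1_ge[OF assms, folded m_def]
  have m0: "0 < m" using j by (intro less_le_trans[OF _ m(2)]) simp
  have sk: "1 \<le> sqrt (real k)" using k by simp
  have "sqrt (real j) / (9 * real k) * (1 / sqrt (real j)) \<le> m * m"
    using m m0 by (intro mult_mono) auto
  then have "1 / (9 * real k) \<le> m\<^sup>2" using j by (simp add: power2_eq_square)
  then have "1 \<le> 9 * real k * m\<^sup>2" using k by (simp add: divide_le_eq mult.commute)
  \<comment> \<open>The constant grows to the square of 9, so that both alternatives share the
    factor 9.\<close>
  also have "\<dots> \<le> 81 * real k * m\<^sup>2" by (intro mult_right_mono) auto
  also have "\<dots> = (9 * sqrt (real k) * m)\<^sup>2" by (simp add: power_mult_distrib)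
  finally have "1\<^sup>2 \<le> (9 * sqrt (real k) * m)\<^sup>2" by simp
  then have 1: "1 \<le> 9 * sqrt (real k) * m" by (rule power2_le_imp_le) (use m0 in simp)
  have "sqrt (real j) / real k \<le> 9 * m" using m(1) by simp
  also have "\<dots> \<le> (9 * m) * sqrt (real k)" using mult_left_mono[OF sk, of "9 * m"] m0 by simp
  finally have 2: "sqrt (real j) / real k \<le> 9 * sqrt (real k) * m" by (simp add: mult_ac)
  have "max_sphere j (linf_l1 k j) \<le> max 1 (sqrt (real j) / real k)"
    by (rule max_sphere_le[OF n]) (rule linf_l1_le_on_sphere[OF k])
  also have "\<dots> \<le> 9 * sqrt (real k) * m" using 1 2 by simp
  finally show ?thesis unfolding mc_def m_def[symmetric] using m0 by (simp add: divide_le_eq)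
qed

text \<open>In dimension \<open>k\<close> the l1 / k part is an average of absolute coordinates, so
  a common bound on the coordinates bounds the norm. The median is then small, while a basis vector
  has norm at least 1.\<close>

lemma mc_linf_l1_ge:
  assumes k: "1 \<le> k"
  shows "sqrt (real k / (ln (real k) + 1)) / 40 \<le> mc k (linf_l1 k k)"
proof -
  interpret lipschitz_homogeneous k "linf_l1 k k" 1
    by (rule lipschitz_homogeneous_linf_l1[OF assms assms])
  let ?t = "40 * sqrt ((1 + ln (real k)) / real k)"
  have m0: "0 < median_sphere k (linf_l1 k k)"
    using k by (intro less_le_trans[OF _ median_linf_l1_ge(2)[OF k k]]) simp
  have m: "median_sphere k (linf_l1 k k) \<le> ?t"
  proof (rule median_sphere_le)
    fix x :: "nat \<Rightarrow> real" assume x: "\<And>i. i < k \<Longrightarrow> \<bar>x i\<bar> \<le> ?t"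
    have "(\<Sum>i<k. \<bar>x i\<bar>) \<le> (\<Sum>i<k. ?t)" using x by (intro sum_mono) auto
    also have "\<dots> = real k * ?t" by simp
    finally have "(\<Sum>i<k. \<bar>x i\<bar>) / real k \<le> ?t" using k by (simp only: divide_le_eq) (simp add: mult.commute)
    then show "linf_l1 k k x \<le> ?t" using x by (rule linf_l1_le)
  qed
  define v where "v = (\<lambda>i\<in>{..<k}. if i = 0 then 1 else 0 :: real)"
  have "(\<Sum>i<k. (v i)\<^sup>2) = (\<Sum>i<k. if i = 0 then 1 else 0)" by (intro sum.cong) (auto simp: v_def)
  also have "\<dots> = 1" using k by simp
  finally have v: "v \<in> rn_sphere k" by (simp add: rn_sphere_def rn_def L2_set_def v_def)
  have "1 = \<bar>v 0\<bar>" using k by (simp add: v_def)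
  also have "\<dots> \<le> linf_l1 k k v" using k by (intro linf_l1_ge(2)) simp
  also have "\<dots> \<le> max_sphere k (linf_l1 k k)"
    by (rule max_sphere_ge[OF v linf_l1_le_on_sphere[OF k]])
  finally have b: "1 \<le> max_sphere k (linf_l1 k k)" .
  have "sqrt (real k / (ln (real k) + 1)) / 40 = 1 / ?t"
    by (simp add: real_sqrt_divide add.commute)
  also have "\<dots> \<le> mc k (linf_l1 k k)"
    unfolding mc_def by (intro frac_le b m0 m order_trans[OF _ b]) auto
  finally show ?thesis .
qed

section \<open>Passage from \<open>mc\<close> to \<open>mmc\<close>, and the theorem\<close>

lemma mmc_le:
  assumes "n > 0" "\<And>j. 1 \<le> j \<Longrightarrow> j \<le> n \<Longrightarrow> mc j (restrict_norm n l j) \<le> b"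
  shows "mmc n l \<le> b"
  unfolding mmc_def using assms by (intro Max.boundedI) auto

lemma mmc_ge:
  assumes "1 \<le> j" "j \<le> n"
  shows "mc j (restrict_norm n l j) \<le> mmc n l"
  unfolding mmc_def using assms by (intro Max_ge) auto

text \<open>The median estimate carries \<open>1 + ln n\<close>. From
  \<open>e \<le> 8 \<le> n^3\<close> follows \<open>1 \<le> 3 * ln n\<close>.\<close>

lemma one_plus_ln_le:
  assumes "n \<ge> 2"
  shows "1 + ln (real n) \<le> 4 * ln (real n)"
proof -
  have "exp 1 \<le> (2::real) ^ 3" using exp_le by simp
  also have "\<dots> \<le> real n ^ 3" using assms by (intro power_mono) auto
  finally have "ln (exp 1) \<le> ln (real n ^ 3)" using assms by (subst ln_le_cancel_iff) auto
  then show ?thesis using assms by (simp add: ln_realpow)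
qed

theorem theorem6p1:
  "\<exists>lam1 lam2 :: real. lam1 > 0 \<and> lam2 > 0 \<and>
     (\<forall>n k :: nat. n \<ge> 2 \<longrightarrow> 1 \<le> k \<longrightarrow> k \<le> n \<longrightarrow>
        lam1 * sqrt (real n / (real k * ln (real n))) \<le> mmc n (topk_norm n k) \<and>
        mmc n (topk_norm n k) \<le> lam2 * sqrt (real n / real k) \<and>
        lam1 * sqrt (real k / (ln (real k) + 1)) \<le> mmc n (dual_norm n (topk_norm n k)) \<and>
        mmc n (dual_norm n (topk_norm n k)) \<le> lam2 * sqrt (real k))"
proof (rule exI[of _ "1 / 80"], rule exI[of _ 9], intro conjI allI impI)
  fix n k :: nat assume n: "2 \<le> n" and k: "1 \<le> k" "k \<le> n"
  have lnn: "0 < ln (real n)" using n by simp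
  \<comment> \<open>The factor 4 leaves the root as 2, which turns 40 into 80.\<close>
  have "sqrt (real n / (real k * ln (real n))) / 80 = sqrt (real n / (real k * (4 * ln (real n)))) / 40"
    by (simp add: real_sqrt_divide real_sqrt_mult)
  also have "\<dots> \<le> sqrt (real n / (real k * (1 + ln (real n)))) / 40"
    using one_plus_ln_le[OF n] k lnn
    by (intro divide_right_mono real_sqrt_le_mono divide_left_mono mult_left_mono mult_pos_pos) auto
  also have "\<dots> \<le> mc n (topk_norm n k)" by (rule mc_topk_norm_ge[OF k])
  also have "topk_norm n k = restrict_norm n (topk_norm n k) n"
    using k n by (simp add: restrict_topk_norm)
  also have "mc n (restrict_norm n (topk_norm n k) n) \<le> mmc n (topk_norm n k)"
    using n by (intro mmc_ge) auto
  finally show "1 / 80 * sqrt (real n / (real k * ln (real n))) \<le> mmc n (topk_norm n k)" by simp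
  show "mmc n (topk_norm n k) \<le> 9 * sqrt (real n / real k)"
  proof (rule mmc_le)
    fix j assume j: "1 \<le> j" "j \<le> n"
    have "mc j (restrict_norm n (topk_norm n k) j) \<le> 9 * sqrt (real j / real (min k j))"
      using k j by (simp only: restrict_topk_norm) (intro mc_topk_norm_le, auto)
    \<comment> \<open>The left side is \<open>j / k\<close> for \<open>k \<le> j\<close> and 1
      otherwise.\<close>
    also have "real j / real (min k j) \<le> real n / real k"
      using k j by (cases "k \<le> j") (auto simp: min_def divide_right_mono)
    finally show "mc j (restrict_norm n (topk_norm n k) j) \<le> 9 * sqrt (real n / real k)" by simp
  qed (use n in simp)
  \<comment> \<open>The dimension \<open>j = k\<close> gives the lower bound with 40; it is weakened
    to the common constant 80.\<close>
  have "sqrt (real k / (ln (real k) + 1)) / 80 \<le> sqrt (real k / (ln (real k) + 1)) / 40"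
    using k by (intro divide_left_mono) auto
  also have "\<dots> \<le> mc k (linf_l1 k k)" by (rule mc_linf_l1_ge[OF k(1)])
  also have "linf_l1 k k = restrict_norm n (dual_norm n (topk_norm n k)) k"
    using k by (simp add: restrict_dual_topk_norm)
  also have "mc k (restrict_norm n (dual_norm n (topk_norm n k)) k) \<le> mmc n (dual_norm n (topk_norm n k))"
    using k by (intro mmc_ge) auto
  finally show "1 / 80 * sqrt (real k / (ln (real k) + 1)) \<le> mmc n (dual_norm n (topk_norm n k))" by simp
  show "mmc n (dual_norm n (topk_norm n k)) \<le> 9 * sqrt (real k)"
  proof (rule mmc_le)
    fix j assume j: "1 \<le> j" "j \<le> n"
    show "mc j (restrict_norm n (dual_norm n (topk_norm n k)) j) \<le> 9 * sqrt (real k)"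
      unfolding restrict_dual_topk_norm[OF k j] by (rule mc_linf_l1_le[OF k(1) j(1)])
  qed (use n in simp)
qed simp_all

end
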